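(* $\mathrm{FO}(<,\lhd,C,Q)$ has the same expressive power as $\mathrm{FO}(\mathrm{Bit})$ on the class of all finite structures.
   Context: Built-in predicates: a $k$-ary numerical predicate is a relation $P\subseteq\mathbb{N}^k$; on a finite structure with universe $[n]=\{0,1,\dots,n\}$ (for some $n\in\mathbb{N}$) it is interpreted as $P^n=P\cap[n]^k$. For a list $\ell$ of such predicates, $\mathrm{FO}(\ell)$ is first-order logic over finite structures with universe $[n]$ (for arbitrary $n$ and an arbitrary finite relational signature) in which, in addition, symbols for the predicates in $\ell$ may be used, interpreted as $P^n$. Two such logics have the same expressive power if every formula of either logic is equivalent, on all finite structures, to a formula of the other. Here $<$ is the usual order on $\mathbb{N}$ and $\mathrm{Bit}=\{(a,i)\in\mathbb{N}^2 : 2\nmid\lfloor a/2^i\rfloor\}$. Let $q_i=\frac{i(i+1)}{2}$ for $i\in\mathbb{N}$. For $x\in\mathbb{N}$ let $c(x)=\max\{i\in\mathbb{N}: q_i\le x\}$ (the column of $x$), $q(x)=q_{c(x)}$, and $r(x)=x-q(x)$ (the row of $x$); so $0\le r(x)\le c(x)$. Define the linear order $\lhd$ on $\mathbb{N}$ by $x\lhd y$ iff $r(x)<r(y)$, or $r(x)=r(y)$ and $c(x)<c(y)$. Define unary predicates $C=\{x\in\mathbb{N}: 2\nmid\lfloor (c(x)+1)/2^{r(x)}\rfloor\}$ (bit $r(x)$ of $c(x)+1$ is 1) and $Q=\{x\in\mathbb{N}: 2\nmid\lfloor q_{c(x)+1}/2^{r(x)}\rfloor\}$ (bit $r(x)$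 of $q_{c(x)+1}$ is 1). *)

theory Defs
  imports Main
begin

text \<open>Formulas over an arbitrary relational signature (relation symbols of type 'r,
  arity given by the length of the argument list) and built-in predicate symbols of
  type 'p. Variables are natural numbers.\<close>

datatype ('r, 'p) fo =
    Eq nat nat
  | Rel 'r "nat list"
  | Pred 'p "nat list"
  | Neg "('r, 'p) fo"
  | Conj "('r, 'p) fo" "('r, 'p) fo"
  | Ex nat "('r, 'p) fo"

text \<open>Semantics on the finite structure with universe [n] = {0..n}, interpretation I of
  the relation symbols, built-in predicates given by \<open>L\<close> (a k-ary predicate is a set of
  length-k lists of naturals; its interpretation on [n] is its restriction to [n]^k, which
  is automatic since variables range over [n]), and assignment e.\<close>

fun sat :: "('p \<Rightarrow> nat list set) \<Rightarrow> nat \<Rightarrow> ('r \<Rightarrow> nat list \<Rightarrow> bool) \<Rightarrow> (nat \<Rightarrow> nat)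
             \<Rightarrow> ('r, 'p) fo \<Rightarrow> bool" where
  "sat L n I e (Eq x y) = (e x = e y)"
| "sat L n I e (Rel R xs) = I R (map e xs)"
| "sat L n I e (Pred P xs) = (map e xs \<in> L P)"
| "sat L n I e (Neg \<phi>) = (\<not> sat L n I e \<phi>)"
| "sat L n I e (Conj \<phi> \<psi>) = (sat L n I e \<phi> \<and> sat L n I e \<psi>)"
| "sat L n I e (Ex x \<phi>) = (\<exists>a\<le>n. sat L n I (e(x := a)) \<phi>)"

definition fo_equiv :: "('p \<Rightarrow> nat list set) \<Rightarrow> ('r, 'p) fo \<Rightarrow> ('q \<Rightarrow> nat list set) \<Rightarrow> ('r, 'q) fo \<Rightarrow> bool" where
  "fo_equiv L1 \<phi> L2 \<psi> \<longleftrightarrow>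
     (\<forall>n I e. (\<forall>x. e x \<le> n) \<longrightarrow> (sat L1 n I e \<phi> \<longleftrightarrow> sat L2 n I e \<psi>))"

definition same_expressive_power ::
  "('p \<Rightarrow> nat list set) \<Rightarrow> ('q \<Rightarrow> nat list set) \<Rightarrow> 'r itself \<Rightarrow> bool" where
  "same_expressive_power L1 L2 _ \<longleftrightarrow>
     (\<forall>\<phi> :: ('r, 'p) fo. \<exists>\<psi> :: ('r, 'q) fo. fo_equiv L1 \<phi> L2 \<psi>) \<and>
     (\<forall>\<psi> :: ('r, 'q) fo. \<exists>\<phi> :: ('r, 'p) fo. fo_equiv L1 \<phi> L2 \<psi>)"

definition tri :: "nat \<Rightarrow> nat" where "tri i = i * (i + 1) div 2"

definition col :: "nat \<Rightarrow> nat" where "col x = (GREATEST i. tri i \<le> x)"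

definition qq :: "nat \<Rightarrow> nat" where "qq x = tri (col x)"

definition row :: "nat \<Rightarrow> nat" where "row x = x - qq x"

definition lhd :: "nat \<Rightarrow> nat \<Rightarrow> bool" where
  "lhd x y \<longleftrightarrow> row x < row y \<or> (row x = row y \<and> col x < col y)"

definition Cset :: "nat set" where
  "Cset = {x. odd ((col x + 1) div 2 ^ row x)}"

definition Qset :: "nat set" where
  "Qset = {x. odd (tri (col x + 1) div 2 ^ row x)}"

definition Bit :: "(nat \<times> nat) set" where
  "Bit = {(a, i). odd (a div 2 ^ i)}"

datatype pred4 = PLess | PLhd | PC | PQ

fun ell_LCQ :: "pred4 \<Rightarrow> nat list set" where
  "ell_LCQ PLess = {[x, y] | x y. x < y}"
| "ell_LCQ PLhd = {[x, y] | x y. lhd x y}"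
| "ell_LCQ PC = {[x] | x. x \<in> Cset}"
| "ell_LCQ PQ = {[x] | x. x \<in> Qset}"

definition ell_Bit :: "unit \<Rightarrow> nat list set" where
  "ell_Bit _ = {[a, i] | a i. (a, i) \<in> Bit}"

end

theory Submission
  imports Defs
begin

text \<open>A formula can be translated as soon as the built-in predicates of one logic are definable in
  the other.

  In FO(Bit) the order is definable by reading numbers as hereditarily finite sets, and addition by
  carry lookahead. Multiplication is checked modulo all small moduli: \<open>a * x mod m\<close> is computed by
  Horner's scheme on the \<open>O(log n)\<close> bits of \<open>x\<close>, with states of \<open>O(log log n)\<close> bits. A single number
  up to \<open>n\<close> holds a run of \<open>sqrt (log n)\<close> such steps, so two nested levels of guessed runs suffice.
  Columns and rows are then definable.

  In FO(<, lhd, C, Q) rows and columns are definable from the two orders. The bits of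
  \<open>x = tri (col x) + row x\<close> are obtained by carry lookahead from the bits of \<open>tri (col x)\<close>, which
  Q stores in the preceding column, and those of \<open>row x\<close>, which C stores in column \<open>row x - 1\<close>.
  A number \<open>i\<close> is identified with column \<open>i\<close>, and hence with row \<open>i\<close>, by comparing bits.\<close>

section \<open>Definable predicates\<close>

text \<open>The obstacle throughout is that every quantified value must be at most \<open>n\<close>.
  A number up to \<open>n\<close> carries only about \<open>log n\<close> bits, so a recursion is
  definable only if its whole run, or a code of its result, can be guessed at that size. All states
  of a Horner run together exceed it; hence the run is cut into blocks, and the outer run guesses
  only the states between blocks. Intermediate sums, products and \<open>tri (col x + 1)\<close> may
  also leave the universe; they are replaced by their bits, by residues, or by halving before
  multiplying. Multiplication serves only to define \<open>tri\<close>; in the other direction C and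
  Q tabulate the numbers required. The shift by one in C and Q fits the table exactly: column
  \<open>c\<close> has the rows \<open>0\<close> to \<open>c\<close>, enough for all bits of
  \<open>c + 1\<close> and of \<open>tri (c + 1) < 2 ^ (c + 1)\<close>. Size estimates that fail for
  small \<open>n\<close> cost only a finite table of exceptions.\<close>

primrec fv :: "('r, 'p) fo \<Rightarrow> nat set" where
  "fv (Eq x y) = {x, y}"
| "fv (Rel R xs) = set xs"
| "fv (Pred P xs) = set xs"
| "fv (Neg \<phi>) = fv \<phi>"
| "fv (Conj \<phi> \<psi>) = fv \<phi> \<union> fv \<psi>"
| "fv (Ex x \<phi>) = fv \<phi> - {x}"

lemma finite_fv: "finite (fv \<phi>)"
  by (induction \<phi>) auto

lemma sat_cong_fv:
  "(\<And>x. x \<in> fv \<phi> \<Longrightarrow> e x = e' x) \<Longrightarrow> sat L n I e \<phi> \<longleftrightarrow> sat L n I e' \<phi>"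
proof (induction \<phi> arbitrary: e e')
  case (Eq x y)
  then show ?case by simp
next
  case (Neg \<phi>)
  have "sat L n I e \<phi> = sat L n I e' \<phi>" by (rule Neg.IH) (simp add: Neg.prems)
  then show ?case by simp
next
  case (Rel R xs)
  then have "map e xs = map e' xs" by simp
  then show ?case by (simp only: sat.simps)
next
  case (Pred P xs)
  then have "map e xs = map e' xs" by simp
  then show ?case by (simp only: sat.simps)
next
  case (Conj \<phi> \<psi>)
  have "sat L n I e \<phi> = sat L n I e' \<phi>" by (rule Conj.IH(1)) (simp add: Conj.prems)
  moreover have "sat L n I e \<psi> = sat L n I e' \<psi>" by (rule Conj.IH(2)) (simp add: Conj.prems)
  ultimately show ?case by simp
next
  case (Ex x \<phi>)
  have "sat L n I (e(x := a)) \<phi> = sat L n I (e'(x := a)) \<phi>" for a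
    by (rule Ex.IH) (simp add: Ex.prems)
  then show ?case by simp
qed

text \<open>Since \<open>f\<close> is arbitrary, a binder could capture a renamed free variable;
  each binder therefore moves to a variable outside the image of the free variables.\<close>

lemma ex_rename: "\<exists>\<psi>. \<forall>n I e. sat L n I e \<psi> \<longleftrightarrow> sat L n I (\<lambda>i. e (f i)) \<phi>"
proof (induction \<phi> arbitrary: f)
  case (Eq x y)
  show ?case by (rule exI[of _ "Eq (f x) (f y)"]) simp
next
  case (Rel R xs)
  show ?case by (rule exI[of _ "Rel R (map f xs)"]) (simp add: comp_def)
next
  case (Pred P xs)
  show ?case by (rule exI[of _ "Pred P (map f xs)"]) (simp add: comp_def)
next
  case (Neg \<phi>)
  obtain \<psi> where "\<forall>n I e. sat L n I e \<psi> \<longleftrightarrow> sat L n I (\<lambda>i. e (f i)) \<phi>"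
    using Neg.IH[of f] by blast
  then show ?case by (intro exI[of _ "Neg \<psi>"]) simp
next
  case (Conj \<phi>1 \<phi>2)
  obtain \<psi>1 where "\<forall>n I e. sat L n I e \<psi>1 \<longleftrightarrow> sat L n I (\<lambda>i. e (f i)) \<phi>1"
    using Conj.IH(1)[of f] by blast
  moreover obtain \<psi>2 where "\<forall>n I e. sat L n I e \<psi>2 \<longleftrightarrow> sat L n I (\<lambda>i. e (f i)) \<phi>2"
    using Conj.IH(2)[of f] by blast
  ultimately show ?case by (intro exI[of _ "Conj \<psi>1 \<psi>2"]) simp
next
  case (Ex x \<phi>)
  have "finite (f ` fv \<phi>)" by (simp add: finite_fv)
  then obtain y where y: "y \<notin> f ` fv \<phi>" using ex_new_if_finite[OF infinite_UNIV_nat] by blast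
  obtain \<psi> where \<psi>: "\<forall>n I e. sat L n I e \<psi> \<longleftrightarrow> sat L n I (\<lambda>i. e ((f(x := y)) i)) \<phi>"
    using Ex.IH[of "f(x := y)"] by blast
  have "sat L n I (e(y := a)) \<psi> \<longleftrightarrow> sat L n I ((\<lambda>i. e (f i))(x := a)) \<phi>" for n I e a
    unfolding \<psi>[rule_format] by (rule sat_cong_fv) (use y in auto)
  then show ?case by (intro exI[of _ "Ex y \<psi>"]) (simp only: sat.simps simp_thms)
qed

lemma sat_map_fo: "sat L n I e (map_fo f id \<phi>) \<longleftrightarrow> sat L n (\<lambda>R. I (f R)) e \<phi>"
  by (induction \<phi> arbitrary: e) auto

text \<open>Fixing the signature to \<open>unit\<close> keeps its type out of the notion. As
  \<open>I\<close> is arbitrary, the truth value cannot depend on it, so the formula transfers to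
  any signature.\<close>

definition definable :: "('p \<Rightarrow> nat list set) \<Rightarrow> (nat \<Rightarrow> (nat \<Rightarrow> nat) \<Rightarrow> bool) \<Rightarrow> bool" where
  "definable L P \<longleftrightarrow>
     (\<exists>\<phi> :: (unit, 'p) fo. \<forall>n I e. (\<forall>x. e x \<le> n) \<longrightarrow> (sat L n I e \<phi> \<longleftrightarrow> P n e))"

lemma definable_cong:
  assumes "definable L P" and "\<And>n e. (\<And>x. e x \<le> n) \<Longrightarrow> P n e \<longleftrightarrow> Q n e"
  shows "definable L Q"
proof -
  obtain \<phi> :: "(unit, 'a) fo" where "\<forall>n I e. (\<forall>x. e x \<le> n) \<longrightarrow> (sat L n I e \<phi> \<longleftrightarrow> P n e)"
    using assms(1) unfolding definable_def by blast
  then show ?thesis using assms(2) unfolding definable_def by (intro exI[of _ \<phi>]) simp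
qed

lemma definable_rename:
  assumes "definable L P"
  shows "definable L (\<lambda>n e. P n (\<lambda>i. e (f i)))"
proof -
  obtain \<phi> :: "(unit, 'a) fo" where
    \<phi>: "\<forall>n I e. (\<forall>x. e x \<le> n) \<longrightarrow> (sat L n I e \<phi> \<longleftrightarrow> P n e)"
    using assms unfolding definable_def by blast
  obtain \<psi> where "\<forall>n I e. sat L n I e \<psi> \<longleftrightarrow> sat L n I (\<lambda>i. e (f i)) \<phi>"
    using ex_rename[of L f \<phi>] by blast
  with \<phi> show ?thesis unfolding definable_def by (intro exI[of _ \<psi>]) simp
qed

lemma definable_eq: "definable L (\<lambda>n e. e i = e j)"
  unfolding definable_def by (rule exI[of _ "Eq i j"]) simp

lemma definable_pred: "definable L (\<lambda>n e. map e xs \<in> L p)"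
  unfolding definable_def by (rule exI[of _ "Pred p xs"]) simp

lemma definable_not:
  assumes "definable L P"
  shows "definable L (\<lambda>n e. \<not> P n e)"
proof -
  obtain \<phi> :: "(unit, 'a) fo" where "\<forall>n I e. (\<forall>x. e x \<le> n) \<longrightarrow> (sat L n I e \<phi> \<longleftrightarrow> P n e)"
    using assms unfolding definable_def by blast
  then show ?thesis unfolding definable_def by (intro exI[of _ "Neg \<phi>"]) simp
qed

lemma definable_conj:
  assumes "definable L P" "definable L Q"
  shows "definable L (\<lambda>n e. P n e \<and> Q n e)"
proof -
  obtain \<phi> :: "(unit, 'a) fo" where "\<forall>n I e. (\<forall>x. e x \<le> n) \<longrightarrow> (sat L n I e \<phi> \<longleftrightarrow> P n e)"
    using assms(1) unfolding definable_def by blast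
  moreover obtain \<psi> :: "(unit, 'a) fo" where
    "\<forall>n I e. (\<forall>x. e x \<le> n) \<longrightarrow> (sat L n I e \<psi> \<longleftrightarrow> Q n e)"
    using assms(2) unfolding definable_def by blast
  ultimately show ?thesis unfolding definable_def by (intro exI[of _ "Conj \<phi> \<psi>"]) simp
qed

lemma definable_disj:
  assumes "definable L P" "definable L Q"
  shows "definable L (\<lambda>n e. P n e \<or> Q n e)"
  using definable_not[OF definable_conj[OF definable_not[OF assms(1)] definable_not[OF assms(2)]]]
  by simp

lemma definable_imp:
  assumes "definable L P" "definable L Q"
  shows "definable L (\<lambda>n e. P n e \<longrightarrow> Q n e)"
  using definable_disj[OF definable_not[OF assms(1)] assms(2)] by simp

lemma definable_iff:
  assumes "definable L P" "definable L Q"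
  shows "definable L (\<lambda>n e. P n e \<longleftrightarrow> Q n e)"
  using definable_conj[OF definable_imp[OF assms] definable_imp[OF assms(2,1)]]
  by (simp only: iff_conv_conj_imp)

lemma definable_True: "definable L (\<lambda>n e. True)"
  by (rule definable_cong[OF definable_eq[of L 0 0]]) simp

lemma definable_False: "definable L (\<lambda>n e. False)"
  by (rule definable_cong[OF definable_not[OF definable_True]]) simp

text \<open>Environments are read as de Bruijn contexts: index 0 is the variable bound last. In this
  form the rule needs no freshness condition, so definability goals are closed by resolution.\<close>

lemma definable_ex:
  assumes "definable L (\<lambda>n e. Q n (\<lambda>i. e (Suc i)) (e 0))"
  shows "definable L (\<lambda>n e. \<exists>a\<le>n. Q n e a)"
proof -
  obtain \<phi> :: "(unit, 'a) fo" where
    \<phi>: "\<And>n I e. (\<forall>x. e x \<le> n) \<Longrightarrow> sat L n I e \<phi> \<longleftrightarrow> Q n (\<lambda>i. e (Suc i)) (e 0)"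
    using assms unfolding definable_def by blast
  \<comment> \<open>Under \<open>f\<close> index 0 becomes \<open>z\<close> and \<open>Suc i\<close>
    becomes \<open>i\<close>, so only \<open>Suc z\<close> could clash with the new variable; 0 is
    inserted to make the fresh index a successor.\<close>
  obtain z where z: "Suc z \<notin> fv \<phi>"
    using ex_new_if_finite[OF infinite_UNIV_nat, of "insert 0 (fv \<phi>)"]
    by (metis finite_fv finite_insert insertCI not0_implies_Suc)
  define f where "f = case_nat z (\<lambda>i. i)"
  obtain \<psi> where \<psi>: "\<And>n I e. sat L n I e \<psi> \<longleftrightarrow> sat L n I (\<lambda>i. e (f i)) \<phi>"
    using ex_rename[of L f \<phi>] by blast
  have "sat L n I (e(z := a)) \<psi> \<longleftrightarrow> sat L n I (case_nat a e) \<phi>" for n I e a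
    unfolding \<psi> by (rule sat_cong_fv) (use z in \<open>auto simp: f_def split: nat.split\<close>)
  moreover have "sat L n I (case_nat a e) \<phi> \<longleftrightarrow> Q n e a" if "\<forall>x. e x \<le> n" "a \<le> n" for n I e a
    using \<phi>[of "case_nat a e"] that by (auto split: nat.split)
  ultimately show ?thesis
    unfolding definable_def by (intro exI[of _ "Ex z \<psi>"]) (auto simp del: fun_upd_apply)
qed

lemma definable_all:
  assumes "definable L (\<lambda>n e. Q n (\<lambda>i. e (Suc i)) (e 0))"
  shows "definable L (\<lambda>n e. \<forall>a\<le>n. Q n e a)"
  by (rule definable_cong[OF definable_not[OF definable_ex[OF definable_not[OF assms]]]]) simp

lemma definable_finite_disj:
  assumes "finite S" and "\<And>s. s \<in> S \<Longrightarrow> definable L (P s)"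
  shows "definable L (\<lambda>n e. \<exists>s\<in>S. P s n e)"
  using assms
proof (induction S rule: finite_induct)
  case empty
  then show ?case by (simp add: definable_False)
next
  case (insert s S)
  then show ?case by (simp add: definable_disj)
qed

lemmas fo_intros = definable_eq definable_not definable_conj definable_disj definable_imp
  definable_iff definable_ex definable_all definable_True definable_False

section \<open>Constants and small universes over a definable order\<close>

locale definable_order =
  fixes L :: "'p \<Rightarrow> nat list set"
  assumes definable_less: "definable L (\<lambda>n e. e i < e j)"
begin

lemma definable_le: "definable L (\<lambda>n e. e i \<le> e j)"
  using definable_not[OF definable_less] by (simp add: not_less)

lemma definable_Suc: "definable L (\<lambda>n e. e i = Suc (e j))"
proof (rule definable_cong)
  show "definable L (\<lambda>n e. e j < e i \<and> (\<forall>z\<le>n. \<not> (e j < z \<and> z < e i)))"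
    by (intro fo_intros definable_less)
  show "(e j < e i \<and> (\<forall>z\<le>n. \<not> (e j < z \<and> z < e i))) = (e i = Suc (e j))" if "\<And>x. e x \<le> n" for n e
    using that[of i] by (metis Suc_lessI lessI less_imp_le_nat less_le_trans not_less_eq)
qed

lemma definable_const: "definable L (\<lambda>n e. e i = c)"
proof (induction c arbitrary: i)
  case 0
  have "definable L (\<lambda>n e. \<forall>y\<le>n. \<not> y < e i)" by (intro fo_intros definable_less)
  then show ?case by (rule definable_cong) auto
next
  case (Suc c)
  have "definable L (\<lambda>n e. \<exists>y\<le>n. e i = Suc y \<and> y = c)"
    by (intro fo_intros definable_Suc Suc)
  moreover have "(\<exists>y\<le>n. e i = Suc y \<and> y = c) = (e i = Suc c)" if "\<And>x. e x \<le> n" for n and e :: "nat \<Rightarrow> nat"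
    using that[of i] by auto
  ultimately show ?case by (rule definable_cong)
qed

lemma definable_size: "definable L (\<lambda>n e. n = c)"
proof -
  have "definable L (\<lambda>n e. \<exists>y\<le>n. y = c \<and> (\<forall>z\<le>n. z \<le> y))"
    by (intro fo_intros definable_const definable_le)
  then show ?thesis by (rule definable_cong) (auto intro: antisym)
qed

text \<open>Below the threshold only finitely many triples of values occur, and \<open>Q\<close>
  looks at the values but not at \<open>n\<close>; so there the predicate is a finite table.\<close>

lemma definable_if_eventually:
  assumes "definable L P"
    and "\<And>n e. N \<le> n \<Longrightarrow> (\<And>x. e x \<le> n) \<Longrightarrow> P n e \<longleftrightarrow> Q (e i) (e j) (e k)"
  shows "definable L (\<lambda>n e. Q (e i) (e j) (e k))"
proof (rule definable_cong)
  define S where "S = {(a, b, c). a < N \<and> b < N \<and> c < N \<and> Q a b c}"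
  have "S \<subseteq> {..<N} \<times> {..<N} \<times> {..<N}" by (auto simp: S_def)
  then have fin: "finite S" by (rule finite_subset) simp
  show "definable L (\<lambda>n e. (\<not> (\<exists>m\<in>{..<N}. n = m) \<and> P n e) \<or>
    ((\<exists>m\<in>{..<N}. n = m) \<and> (\<exists>s\<in>S. e i = fst s \<and> e j = fst (snd s) \<and> e k = snd (snd s))))"
    by (intro fo_intros definable_finite_disj fin definable_const definable_size assms(1)) simp_all
  show "((\<not> (\<exists>m\<in>{..<N}. n = m) \<and> P n e) \<or>
    ((\<exists>m\<in>{..<N}. n = m) \<and> (\<exists>s\<in>S. e i = fst s \<and> e j = fst (snd s) \<and> e k = snd (snd s))))
    \<longleftrightarrow> Q (e i) (e j) (e k)" if e: "\<And>x. e x \<le> n" for n e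
  proof (cases "N \<le> n")
    case True
    then show ?thesis using assms(2)[OF True e] by auto
  next
    case False
    then have "e i < N" "e j < N" "e k < N" using e by (meson le_less_trans not_le)+
    then show ?thesis using False by (auto simp: S_def)
  qed
qed

end

text \<open>Only built-in atoms change. Their argument lists may repeat variables and have any
  length, so the assumption speaks of the variables \<open>0..<k\<close> for every \<open>k\<close>,
  and renaming supplies the actual list.\<close>

lemma ex_fo_equiv:
  fixes L1 :: "'p \<Rightarrow> nat list set" and L2 :: "'q \<Rightarrow> nat list set" and \<phi> :: "('r, 'p) fo"
  assumes "\<And>p k. definable L2 (\<lambda>n e. map e [0..<k] \<in> L1 p)"
  shows "\<exists>\<psi> :: ('r, 'q) fo. fo_equiv L1 \<phi> L2 \<psi>"
proof (induction \<phi>)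
  case (Eq x y)
  show ?case by (rule exI[of _ "Eq x y"]) (simp add: fo_equiv_def)
next
  case (Rel R xs)
  show ?case by (rule exI[of _ "Rel R xs"]) (simp add: fo_equiv_def)
next
  case (Pred p xs)
  have "definable L2 (\<lambda>n e. map (\<lambda>i. e (xs ! i)) [0..<length xs] \<in> L1 p)"
    using definable_rename[OF assms[of "length xs" p], of "\<lambda>i. xs ! i"] by simp
  moreover have "map (\<lambda>i. e (xs ! i)) [0..<length xs] = map e xs" for e :: "nat \<Rightarrow> nat"
    by (rule nth_equalityI) auto
  ultimately obtain \<psi> :: "(unit, 'q) fo" where
    "\<And>n I e. (\<forall>x. e x \<le> n) \<Longrightarrow> sat L2 n I e \<psi> \<longleftrightarrow> map e xs \<in> L1 p"
    unfolding definable_def by auto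
  \<comment> \<open>The symbol of the signature \<open>unit\<close> may be sent anywhere, because
    \<open>\<psi>\<close> is correct for every interpretation.\<close>
  then show ?case
    by (intro exI[of _ "map_fo (\<lambda>_. undefined) id \<psi>"]) (simp add: fo_equiv_def sat_map_fo)
next
  case (Neg \<phi>)
  then obtain \<psi> where "fo_equiv L1 \<phi> L2 \<psi>" by blast
  then show ?case by (intro exI[of _ "Neg \<psi>"]) (simp add: fo_equiv_def)
next
  case (Conj \<phi>1 \<phi>2)
  then obtain \<psi>1 \<psi>2 where "fo_equiv L1 \<phi>1 L2 \<psi>1" "fo_equiv L1 \<phi>2 L2 \<psi>2" by blast
  then show ?case by (intro exI[of _ "Conj \<psi>1 \<psi>2"]) (simp add: fo_equiv_def)
next
  case (Ex x \<phi>)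
  then obtain \<psi> where "fo_equiv L1 \<phi> L2 \<psi>" by blast
  then show ?case by (intro exI[of _ "Ex x \<psi>"]) (auto simp: fo_equiv_def)
qed

section \<open>Bits and residues\<close>

lemma exp_le_if_bit: "2 ^ i \<le> x" if "bit x i" for x :: nat
proof (rule ccontr)
  assume "\<not> 2 ^ i \<le> x"
  with that show False by (simp add: bit_iff_odd)
qed

lemma less_if_bit: "i < x" if "bit x i" for x :: nat
  using exp_le_if_bit[OF that] less_exp[of i] by linarith

lemma le_if_bit: "i \<le> n" if "bit x i" "x \<le> n" for x :: nat
  using less_if_bit[OF that(1)] that(2) by linarith

lemma not_bit_if_less_exp: "\<not> bit x j" if "x < 2 ^ i" "i \<le> j" for x :: nat
proof
  assume "bit x j"
  then have "2 ^ i \<le> x"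
    using exp_le_if_bit[of x j] that(2) by (meson le_trans one_le_numeral power_increasing)
  with that(1) show False by simp
qed

lemma less_exp_if_not_bit: "x < 2 ^ i" if "\<And>j. i \<le> j \<Longrightarrow> \<not> bit x j" for x :: nat
proof -
  have "take_bit i x = x"
    by (rule bit_eqI) (metis bit_take_bit_iff not_less that)
  then show ?thesis by (metis take_bit_nat_less_exp)
qed

lemma eq_if_bits_eq:
  fixes x y :: nat
  assumes "x < 2 ^ Suc n" "y < 2 ^ Suc n" "\<And>i. i \<le> n \<Longrightarrow> bit x i \<longleftrightarrow> bit y i"
  shows "x = y"
  by (rule bit_eqI) (metis assms not_bit_if_less_exp not_less_eq_eq)

text \<open>After division by \<open>2 ^ c\<close> the two numbers have the form
  \<open>2 * h\<close> and \<open>2 * h + 1\<close>, and division is monotone.\<close>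

lemma less_if_top_bit:
  fixes a b :: nat
  assumes "bit b c" "\<not> bit a c" "\<And>d. c < d \<Longrightarrow> bit a d \<longleftrightarrow> bit b d"
  shows "a < b"
proof -
  have "drop_bit (Suc c) a = drop_bit (Suc c) b"
    by (rule bit_eqI) (simp add: bit_drop_bit_eq assms(3))
  then have "a div 2 ^ c div 2 = b div 2 ^ c div 2"
    by (simp add: drop_bit_eq_div flip: div_mult2_eq add: mult.commute)
  moreover have "odd (b div 2 ^ c)" "even (a div 2 ^ c)" using assms by (simp_all add: bit_iff_odd)
  ultimately have "a div 2 ^ c < b div 2 ^ c"
    by (metis even_two_times_div_two less_Suc_eq odd_two_times_div_two_succ Suc_eq_plus1)
  then show ?thesis by (meson div_le_mono leD not_le)
qed

text \<open>The witness \<open>c\<close> is the largest position at which the numbers differ.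
  Splitting \<open>d \<le> c\<close> into two cases prepares for replacing \<open><\<close> by
  another relation.\<close>

lemma less_iff_top_bit:
  fixes a b :: nat
  shows "a < b \<longleftrightarrow> (\<exists>c. bit b c \<and> \<not> bit a c \<and> (\<forall>d. bit a d \<noteq> bit b d \<longrightarrow> d = c \<or> d < c))"
proof
  assume "\<exists>c. bit b c \<and> \<not> bit a c \<and> (\<forall>d. bit a d \<noteq> bit b d \<longrightarrow> d = c \<or> d < c)"
  then obtain c where "bit b c" "\<not> bit a c" "\<And>d. c < d \<Longrightarrow> bit a d \<longleftrightarrow> bit b d"
    by (metis less_asym less_irrefl)
  then show "a < b" by (rule less_if_top_bit)
next
  assume "a < b"
  define D where "D = {d. bit a d \<noteq> bit b d}"
  have "D \<subseteq> {..b}" using \<open>a < b\<close> by (auto simp: D_def dest!: less_if_bit)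
  then have fin: "finite D" using finite_subset by blast
  have "D \<noteq> {}" using \<open>a < b\<close> bit_eqI[of a b] by (auto simp: D_def)
  define c where "c = Max D"
  have c: "c \<in> D" unfolding c_def using fin \<open>D \<noteq> {}\<close> by (rule Max_in)
  have max: "d \<le> c" if "bit a d \<noteq> bit b d" for d
    unfolding c_def by (rule Max_ge[OF fin]) (use that in \<open>simp add: D_def\<close>)
  have "\<not> bit a c"
  proof
    assume "bit a c"
    then have "b < a" using c max by (intro less_if_top_bit) (auto simp: D_def not_le[symmetric])
    with \<open>a < b\<close> show False by simp
  qed
  then show "\<exists>c. bit b c \<and> \<not> bit a c \<and> (\<forall>d. bit a d \<noteq> bit b d \<longrightarrow> d = c \<or> d < c)"
    using c max by (intro exI[of _ c]) (auto simp: D_def order_le_less)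
qed

lemma ex_bits: "\<exists>w::nat. w < 2 ^ N \<and> (\<forall>i. bit w i \<longleftrightarrow> i \<in> S)" if "S \<subseteq> {..<N}" for S :: "nat set"
proof -
  have "\<exists>w::nat. \<forall>i. bit w i \<longleftrightarrow> i \<in> S" if "finite S"
    using that
  proof (induction S)
    case empty
    show ?case by (rule exI[of _ 0]) simp
  next
    case (insert k S)
    then obtain w :: nat where "\<forall>i. bit w i \<longleftrightarrow> i \<in> S" by blast
    then show ?case by (intro exI[of _ "set_bit k w"]) (auto simp: bit_set_bit_iff)
  qed
  then obtain w :: nat where w: "\<forall>i. bit w i \<longleftrightarrow> i \<in> S"
    using finite_subset[OF \<open>S \<subseteq> {..<N}\<close>] by blast
  with that have "w < 2 ^ N" by (intro less_exp_if_not_bit) auto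
  with w show ?thesis by blast
qed

section \<open>Carry lookahead\<close>

text \<open>The left side is the carry into position \<open>j\<close>: some \<open>k\<close>
  generates it and all positions in between propagate it. Unlike the recursion for carries, this is
  first-order over the bits.\<close>

lemma carry_iff:
  fixes a b :: nat
  shows "2 ^ j \<le> take_bit j a + take_bit j b \<longleftrightarrow>
    (\<exists>k<j. bit a k \<and> bit b k \<and> (\<forall>l. k < l \<and> l < j \<longrightarrow> bit a l \<or> bit b l))"
    (is "?c j \<longleftrightarrow> ?R j")
proof (induction j)
  case 0
  then show ?case by simp
next
  case (Suc j)
  have lt: "take_bit j a < 2 ^ j" "take_bit j b < 2 ^ j" by simp_all
  have "?c (Suc j) \<longleftrightarrow> bit a j \<and> bit b j \<or> (bit a j \<or> bit b j) \<and> ?c j"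
    unfolding take_bit_Suc_from_most using lt by (auto simp del: take_bit_nat_less_exp)
  also have "\<dots> \<longleftrightarrow> ?R (Suc j)"
    unfolding Suc by (auto simp: less_Suc_eq)
  finally show ?case .
qed

text \<open>The sum bit is the exclusive or of two bits and the carry, which for three operands
  agrees with the iterated equivalence.\<close>

lemma bit_add_iff:
  fixes a b :: nat
  shows "bit (a + b) j \<longleftrightarrow> ((bit a j \<longleftrightarrow> bit b j) \<longleftrightarrow>
    (\<exists>k<j. bit a k \<and> bit b k \<and> (\<forall>l. k < l \<and> l < j \<longrightarrow> bit a l \<or> bit b l)))"
proof -
  have lt: "take_bit j a < 2 ^ j" "take_bit j b < 2 ^ j" by simp_all
  have "a = a div 2 ^ j * 2 ^ j + take_bit j a" "b = b div 2 ^ j * 2 ^ j + take_bit j b"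
    by (simp_all only: take_bit_eq_mod div_mult_mod_eq)
  then have "a + b = (a div 2 ^ j + b div 2 ^ j) * 2 ^ j + (take_bit j a + take_bit j b)"
    by (simp add: algebra_simps)
  then have "(a + b) div 2 ^ j = a div 2 ^ j + b div 2 ^ j + (take_bit j a + take_bit j b) div 2 ^ j"
    by simp
  also have "(take_bit j a + take_bit j b) div 2 ^ j = of_bool (2 ^ j \<le> take_bit j a + take_bit j b)"
    using lt by (auto intro!: div_nat_eqI simp del: take_bit_nat_less_exp)
  finally show ?thesis unfolding carry_iff[symmetric] by (simp add: bit_iff_odd)
qed

text \<open>The divisibility comes from the recursion
  \<open>1 / ((m + 1) C(n, m + 1)) = 1 / (m C(n - 1, m)) - 1 / (m C(n, m))\<close> of the Leibniz triangle.\<close>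

lemma times_binomial_dvd:
  fixes D :: nat
  assumes "\<And>i. 1 \<le> i \<Longrightarrow> i \<le> n \<Longrightarrow> i dvd D" "1 \<le> m" "m \<le> n"
  shows "m * (n choose m) dvd D"
  using assms(2,3,1)
proof (induction m arbitrary: n rule: dec_induct)
  case base
  then show ?case by simp
next
  case (step m)
  then obtain n' where n: "n = Suc n'" by (cases n) auto
  define X Y Z where "X = m * (n' choose m)" and "Y = m * (n choose m)"
    and "Z = Suc m * (n choose Suc m)"
  have "X dvd D" unfolding X_def using step n by (intro step.IH) auto
  then obtain u where u: "D = X * u" ..
  have "Y dvd D" unfolding Y_def using step n by (intro step.IH) auto
  then obtain v where v: "D = Y * v" ..
  have Z: "Z = n * (n' choose m)" unfolding Z_def n using binomial_absorption[of m "Suc n'"] by simp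
  have "Y = n * (n' choose (m - 1))" unfolding Y_def
    using binomial_absorption[of "m - 1" "Suc n'"] step.hyps n by simp
  moreover have "Y - X = m * (n' choose (m - 1))"
    unfolding Y_def X_def n using choose_reduce_nat[of "Suc n'" m] step.hyps
    by (simp flip: diff_mult_distrib2)
  ultimately have YX: "n * (Y - X) = m * Y" by simp
  \<comment> \<open>This is \<open>1/Z = 1/X - 1/Y\<close> without denominators; accordingly the
    cofactor of \<open>Z\<close> in \<open>D\<close> is \<open>u - v\<close>.\<close>
  have XY: "X * Y = Z * (Y - X)" using YX unfolding Z X_def by (metis mult.assoc mult.commute)
  have pos: "0 < X" "0 < Y" using step n by (auto simp: X_def Y_def zero_less_binomial_iff)
  have "X * Y * (Z * (u - v)) = Z * (X * u * Y - Y * v * X)" by (simp add: algebra_simps)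
  also have "\<dots> = D * (Z * (Y - X))" by (simp flip: u v add: algebra_simps)
  also have "\<dots> = X * Y * D" by (simp flip: XY)
  finally have "Z * (u - v) = D" using pos by simp
  then have "Z dvd D" by (metis dvd_triv_left)
  then show ?case by (simp add: Z_def)
qed

lemma exp_le_central_binomial: "2 ^ k \<le> (2 * k) choose k"
proof (induction k)
  case 0
  then show ?case by simp
next
  case (Suc k)
  have "(2 * Suc k) choose (Suc k) = (Suc (2 * k) choose k) + (Suc (2 * k) choose Suc k)" by simp
  moreover have "(2 * k) choose k \<le> Suc (2 * k) choose k" by (cases k) simp_all
  moreover have "(2 * k) choose k \<le> Suc (2 * k) choose Suc k" by simp
  ultimately show ?case using Suc by simp
qed

text \<open>A positive difference would be divisible by every number up to \<open>2 * k\<close>,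
  hence by \<open>k * ((2 * k) choose k)\<close>; already the binomial is at least
  \<open>2 ^ k\<close>, more than the difference can be.\<close>

lemma eq_if_mod_eq:
  fixes u v :: nat
  assumes "u < 2 ^ k" "v < 2 ^ k" "\<And>m. 2 \<le> m \<Longrightarrow> m \<le> 2 * k \<Longrightarrow> u mod m = v mod m"
  shows "u = v"
proof -
  have *: "u \<le> v" if "u < 2 ^ k" "\<And>m. 2 \<le> m \<Longrightarrow> m \<le> 2 * k \<Longrightarrow> u mod m = v mod m" for u v :: nat
  proof (rule ccontr)
    assume "\<not> u \<le> v"
    then have "0 < k" using that(1) by (cases k) auto
    have "m dvd u - v" if "1 \<le> m" "m \<le> 2 * k" for m
      using \<open>\<not> u \<le> v\<close> that \<open>\<And>m. 2 \<le> m \<Longrightarrow> m \<le> 2 * k \<Longrightarrow> u mod m = v mod m\<close>[of m]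
      by (cases "m = 1") (auto simp: mod_eq_dvd_iff_nat)
    then have "k * ((2 * k) choose k) dvd u - v"
      using \<open>0 < k\<close> by (intro times_binomial_dvd) auto
    then have "(2 * k) choose k \<le> u - v"
      using \<open>\<not> u \<le> v\<close> by (auto intro: dvd_imp_le dest: dvd_mult_right)
    then show False using exp_le_central_binomial[of k] that(1) by linarith
  qed
  show ?thesis using *[of u v] *[of v u] assms by (simp add: antisym)
qed

section \<open>Definability from Bit\<close>

lemma definable_bit: "definable ell_Bit (\<lambda>n e. bit (e i) (e j))"
proof (rule definable_cong)
  show "definable ell_Bit (\<lambda>n e. map e [i, j] \<in> ell_Bit ())" by (rule definable_pred)
qed (simp add: ell_Bit_def Bit_def bit_iff_odd)

text \<open>A number exceeds all its bit positions, so a quantifier over them needs no explicit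
  bound. Set-theoretic definitions can thus be written without mentioning \<open>n\<close>.\<close>

lemma definable_ex_bit:
  assumes "definable ell_Bit (\<lambda>n e. Q n (\<lambda>i. e (Suc i)) (e 0))"
  shows "definable ell_Bit (\<lambda>n e. \<exists>a. bit (e i) a \<and> Q n e a)"
proof (rule definable_cong)
  show "definable ell_Bit (\<lambda>n e. \<exists>a\<le>n. bit (e i) a \<and> Q n e a)"
    by (intro fo_intros definable_bit assms)
  show "(\<exists>a\<le>n. bit (e i) a \<and> Q n e a) = (\<exists>a. bit (e i) a \<and> Q n e a)" if "\<And>x. e x \<le> n" for n e
    using le_if_bit[OF _ that[of i]] by blast
qed

lemma definable_all_bit:
  assumes "definable ell_Bit (\<lambda>n e. Q n (\<lambda>i. e (Suc i)) (e 0))"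
  shows "definable ell_Bit (\<lambda>n e. \<forall>a. bit (e i) a \<longrightarrow> Q n e a)"
  using definable_not[OF definable_ex_bit[OF definable_not[OF assms], of i]] by simp

lemmas bit_intros = fo_intros definable_bit definable_ex_bit definable_all_bit

text \<open>Numbers are read as hereditarily finite sets, with \<open>bit\<close> as membership. The order \<open><\<close>
  compares two sets by their largest differing element, which only determines it recursively. On
  \<open>{..<m}\<close> with \<open>2 ^ 2 ^ m \<le> n + 1\<close> the order is coded by a single number \<open>W \<le> n\<close>,
  the set of its initial segments, and the recursion pins \<open>W\<close> down. Three comparisons by the
  largest differing element then lift the order from \<open>{..<m}\<close> to \<open>{..n}\<close>.\<close>

definition top_less :: "(nat \<Rightarrow> nat \<Rightarrow> bool) \<Rightarrow> nat \<Rightarrow> nat \<Rightarrow> bool" where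
  "top_less R a b \<longleftrightarrow> (\<exists>c. bit b c \<and> \<not> bit a c \<and>
     (\<forall>d. bit a d \<longrightarrow> \<not> bit b d \<longrightarrow> d = c \<or> R d c) \<and>
     (\<forall>d. bit b d \<longrightarrow> \<not> bit a d \<longrightarrow> d = c \<or> R d c))"

definition chain_field :: "nat \<Rightarrow> nat \<Rightarrow> bool" where
  "chain_field W a \<longleftrightarrow> (\<exists>s. bit W s \<and> bit s a)"

definition chain_less :: "nat \<Rightarrow> nat \<Rightarrow> nat \<Rightarrow> bool" where
  "chain_less W a b \<longleftrightarrow> (\<exists>s. bit W s \<and> bit s a \<and> \<not> bit s b)"

definition order_code :: "nat \<Rightarrow> bool" where
  "order_code W \<longleftrightarrow>
     (\<forall>s. bit W s \<longrightarrow> (\<forall>a. bit s a \<longrightarrow> (\<forall>d. bit a d \<longrightarrow> chain_field W d))) \<and>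
     (\<forall>s. bit W s \<longrightarrow> (\<forall>a. bit s a \<longrightarrow> (\<forall>t. bit W t \<longrightarrow> (\<forall>b. bit t b \<longrightarrow>
       (chain_less W a b \<longleftrightarrow> top_less (chain_less W) a b)))))"

definition code_less :: "nat \<Rightarrow> nat \<Rightarrow> nat \<Rightarrow> bool" where
  "code_less n a b \<longleftrightarrow>
     (\<exists>W\<le>n. order_code W \<and> chain_field W a \<and> chain_field W b \<and> chain_less W a b)"

lemma top_less_iff:
  assumes "\<And>c d. bit a c \<or> bit b c \<Longrightarrow> bit a d \<or> bit b d \<Longrightarrow> R d c \<longleftrightarrow> d < c"
  shows "top_less R a b \<longleftrightarrow> a < b"
  unfolding top_less_def less_iff_top_bit[of a b] by (rule iff_exI) (auto simp: assms)

lemma top_less_iff_below: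
  assumes "\<And>c d. c < k \<Longrightarrow> d < k \<Longrightarrow> R c d \<longleftrightarrow> c < d" "a < 2 ^ k" "b < 2 ^ k"
  shows "top_less R a b \<longleftrightarrow> a < b"
proof (rule top_less_iff)
  fix c d assume "bit a c \<or> bit b c" "bit a d \<or> bit b d"
  then have "c < k" "d < k" using assms(2,3) not_bit_if_less_exp not_less by metis+
  then show "R d c \<longleftrightarrow> d < c" using assms(1) by simp
qed

text \<open>By the first clause of \<open>order_code\<close>, elements of field elements are again
  in the field, and they are smaller; so the recursion equation fixes the relation by induction on
  the maximum. All codes therefore agree, and \<open>code_less\<close> may guess any of
  them.\<close>

lemma chain_less_iff:
  assumes "order_code W" "chain_field W a" "chain_field W b"
  shows "chain_less W a b \<longleftrightarrow> a < b"
  using assms(2,3)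
proof (induction "max a b" arbitrary: a b rule: less_induct)
  case less
  have "chain_less W a b \<longleftrightarrow> top_less (chain_less W) a b"
    using assms(1) less.prems unfolding order_code_def chain_field_def by blast
  also have "\<dots> \<longleftrightarrow> a < b"
  proof (rule top_less_iff)
    fix c d
    assume cd: "bit a c \<or> bit b c" "bit a d \<or> bit b d"
    then have "chain_field W c" "chain_field W d"
      using assms(1) less.prems unfolding order_code_def chain_field_def by blast+
    moreover have "max d c < max a b" using cd by (auto dest!: less_if_bit)
    ultimately show "chain_less W d c \<longleftrightarrow> d < c" using less.hyps by blast
  qed
  finally show ?case .
qed

text \<open>The nonempty initial segments of \<open>{..<m}\<close> are the numbers
  \<open>mask k\<close>, all below \<open>2 ^ m\<close>; the set of them is thus a number below
  \<open>2 ^ 2 ^ m\<close>. For \<open>m = 0\<close> the code is 0, which every universe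
  contains.\<close>

lemma ex_order_code:
  assumes "m = 0 \<or> 2 ^ 2 ^ m \<le> n + 1"
  shows "\<exists>W\<le>n. order_code W \<and> (\<forall>a. chain_field W a \<longleftrightarrow> a < m)"
proof -
  have mask_less: "mask k < (2::nat) ^ m" if "k \<le> m" for k
    using that by (simp add: mask_eq_exp_minus_1 less_eq_Suc_le)
  then have "mask ` {1..m} \<subseteq> {..<(2::nat) ^ m}" by auto
  then obtain W :: nat where W: "W < 2 ^ 2 ^ m" "\<forall>i. bit W i \<longleftrightarrow> i \<in> mask ` {1..m}"
    using ex_bits by blast
  have field: "chain_field W a \<longleftrightarrow> a < m" for a
    using W(2) by (auto simp: chain_field_def bit_mask_iff intro!: bexI[of _ m])
  have less: "chain_less W a b \<longleftrightarrow> a < b" if "a < m" "b < m" for a b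
    using W(2) that by (auto simp: chain_less_def bit_mask_iff intro!: bexI[of _ "Suc a"])
  have sub: "d < m" if "a < m" "bit a d" for a d using that less_if_bit by fastforce
  have *: "a < m" if "bit W s" "bit s a" for s a using field that chain_field_def by blast
  have "order_code W"
    unfolding order_code_def
  proof (intro conjI allI impI)
    fix s a d assume "bit W s" "bit s a" "bit a d"
    then show "chain_field W d" using field sub * by blast
  next
    fix s a t b assume "bit W s" "bit s a" "bit W t" "bit t b"
    then have "a < m" "b < m" using * by blast+
    moreover from this have "top_less (chain_less W) a b \<longleftrightarrow> a < b"
      by (intro top_less_iff less) (auto dest: sub)
    ultimately show "chain_less W a b \<longleftrightarrow> top_less (chain_less W) a b" using less by simp
  qed
  moreover have "W \<le> n"
  proof (cases "m = 0")
    case True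
    then have "W = 0" using W(2) by (intro bit_eqI) simp
    then show ?thesis by simp
  next
    case False
    then show ?thesis using assms W(1) by simp
  qed
  ultimately show ?thesis using field by blast
qed

text \<open>For the largest \<open>m\<close> with \<open>2 ^ 2 ^ m \<le> n + 1\<close>, if there is
  one, \<open>n + 1 < 2 ^ 2 ^ (m + 1)\<close>, and \<open>m + 1 \<le> 2 ^ m\<close> turns this into
  a tower of three exponentials over \<open>m\<close>. This is why three lifts are enough.\<close>

lemma ex_tower_bound: "\<exists>m. (m = 0 \<or> 2 ^ 2 ^ m \<le> n + 1) \<and> n < (2::nat) ^ 2 ^ 2 ^ m"
proof -
  define k where "k = (LEAST k. n + 1 < (2::nat) ^ 2 ^ k)"
  have "n + 1 < (2::nat) ^ 2 ^ (n + 1)" by (meson less_exp less_trans)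
  then have k: "n + 1 < (2::nat) ^ 2 ^ k" unfolding k_def by (rule LeastI)
  show ?thesis
  proof (cases k)
    case 0
    with k show ?thesis by (intro exI[of _ 0]) simp
  next
    case (Suc m)
    then have "\<not> n + 1 < (2::nat) ^ 2 ^ m" 
      using not_less_Least[of m "\<lambda>k. n + 1 < (2::nat) ^ 2 ^ k"] unfolding k_def by simp
    moreover have "n < (2::nat) ^ 2 ^ 2 ^ m"
    proof -
      have "Suc m \<le> 2 ^ m" using less_exp[of m] by (simp add: Suc_le_eq)
      then have "(2::nat) ^ 2 ^ Suc m \<le> 2 ^ 2 ^ 2 ^ m" by (intro power_increasing) simp_all
      then show ?thesis using k unfolding Suc by linarith
    qed
    ultimately show ?thesis by (intro exI[of _ m]) simp
  qed
qed

lemma iterated_top_less_iff: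
  assumes "a \<le> n" "b \<le> n"
  shows "top_less (top_less (top_less (code_less n))) a b \<longleftrightarrow> a < b"
proof -
  obtain m where m: "m = 0 \<or> 2 ^ 2 ^ m \<le> n + 1" "n < (2::nat) ^ 2 ^ 2 ^ m"
    using ex_tower_bound by blast
  have 0: "code_less n a b \<longleftrightarrow> a < b" if "a < m" "b < m" for a b
    using ex_order_code[OF m(1)] that chain_less_iff unfolding code_less_def by blast
  have 1: "top_less (code_less n) a b \<longleftrightarrow> a < b" if "a < 2 ^ m" "b < 2 ^ m" for a b
    using top_less_iff_below[OF 0 that] .
  have 2: "top_less (top_less (code_less n)) a b \<longleftrightarrow> a < b"
    if "a < 2 ^ 2 ^ m" "b < 2 ^ 2 ^ m" for a b
    using top_less_iff_below[OF 1 that] .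
  have "a < 2 ^ 2 ^ 2 ^ m" "b < 2 ^ 2 ^ 2 ^ m" using assms m(2) by linarith+
  then show ?thesis using top_less_iff_below[OF 2] by blast
qed

lemma definable_top_less:
  assumes "\<And>i j. definable ell_Bit (\<lambda>n e. R n (e i) (e j))"
  shows "definable ell_Bit (\<lambda>n e. top_less (R n) (e i) (e j))"
  unfolding top_less_def by (intro bit_intros assms)

lemma definable_less_Bit: "definable ell_Bit (\<lambda>n e. e i < e j)"
proof (rule definable_cong)
  have "definable ell_Bit (\<lambda>n e. chain_less (e w) (e i) (e j))" for w i j
    unfolding chain_less_def by (intro bit_intros)
  then have "definable ell_Bit (\<lambda>n e. code_less n (e i) (e j))" for i j
    unfolding code_less_def order_code_def chain_field_def top_less_def by (intro bit_intros)
  then show "definable ell_Bit (\<lambda>n e. top_less (top_less (top_less (code_less n))) (e i) (e j))"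
    by (intro definable_top_less)
qed (simp add: iterated_top_less_iff)

interpretation Bit: definable_order ell_Bit
  by unfold_locales (rule definable_less_Bit)

lemmas order_intros = bit_intros Bit.definable_less Bit.definable_le Bit.definable_Suc
  Bit.definable_const

section \<open>Addition from Bit\<close>

text \<open>The sum itself may exceed \<open>n\<close>; its single bits remain definable, which is
  also what Q requires.\<close>

lemma definable_bit_add: "definable ell_Bit (\<lambda>n e. bit (e i + e j) (e k))"
proof (rule definable_cong)
  show "definable ell_Bit (\<lambda>n e. (bit (e i) (e k) \<longleftrightarrow> bit (e j) (e k)) \<longleftrightarrow>
    (\<exists>l\<le>n. l < e k \<and> bit (e i) l \<and> bit (e j) l \<and>
      (\<forall>h\<le>n. l < h \<and> h < e k \<longrightarrow> bit (e i) h \<or> bit (e j) h)))"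
    by (intro order_intros)
  show "((bit (e i) (e k) \<longleftrightarrow> bit (e j) (e k)) \<longleftrightarrow>
    (\<exists>l\<le>n. l < e k \<and> bit (e i) l \<and> bit (e j) l \<and>
      (\<forall>h\<le>n. l < h \<and> h < e k \<longrightarrow> bit (e i) h \<or> bit (e j) h))) = bit (e i + e j) (e k)"
    if "\<And>x. e x \<le> n" for n e
  proof -
    have *: "l \<le> n" if "l < e k" for l using that \<open>\<And>x. e x \<le> n\<close>[of k] by simp
    show ?thesis unfolding bit_add_iff using * by blast
  qed
qed

text \<open>Both sides are below \<open>2 ^ Suc n\<close>, so comparing the positions up to
  \<open>n\<close> decides equality even for a sum outside the universe.\<close>

lemma definable_add: "definable ell_Bit (\<lambda>n e. e i + e j = e k)"
proof (rule definable_cong)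
  show "definable ell_Bit (\<lambda>n e. \<forall>l\<le>n. bit (e i + e j) l \<longleftrightarrow> bit (e k) l)"
    by (intro order_intros definable_bit_add)
  show "(\<forall>l\<le>n. bit (e i + e j) l \<longleftrightarrow> bit (e k) l) = (e i + e j = e k)"
    if e: "\<And>x. e x \<le> n" for n e
  proof
    have "n < 2 ^ n" by (rule less_exp)
    then have "e i + e j < 2 ^ Suc n" "e k < 2 ^ Suc n" 
      unfolding power_Suc using e[of i] e[of j] e[of k] by linarith+
    moreover assume "\<forall>l\<le>n. bit (e i + e j) l \<longleftrightarrow> bit (e k) l"
    ultimately show "e i + e j = e k" by (intro eq_if_bits_eq[of _ n]) auto
  qed simp
qed

section \<open>Coded paths of small numbers\<close>

definition field_at :: "nat \<Rightarrow> nat \<Rightarrow> nat \<Rightarrow> nat" where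
  "field_at w z p = take_bit w (drop_bit p z)"

lemma field_at_le: "field_at w z p \<le> z"
  unfolding field_at_def by (metis div_le_dividend drop_bit_eq_div order_trans take_bit_nat_less_eq_self)

lemma definable_field_at: "definable ell_Bit (\<lambda>n e. e v = field_at (e w) (e z) (e p))"
proof (rule definable_cong)
  show "definable ell_Bit (\<lambda>n e. \<forall>i\<le>n. bit (e v) i \<longleftrightarrow> i < e w \<and> (\<exists>k\<le>n. e p + i = k \<and> bit (e z) k))"
    by (intro order_intros definable_add)
  show "(\<forall>i\<le>n. bit (e v) i \<longleftrightarrow> i < e w \<and> (\<exists>k\<le>n. e p + i = k \<and> bit (e z) k))
    = (e v = field_at (e w) (e z) (e p))" if e: "\<And>x. e x \<le> n" for n e
  proof -
    have bit_field: "bit (field_at (e w) (e z) (e p)) i \<longleftrightarrow> i < e w \<and> (\<exists>k\<le>n. e p + i = k \<and> bit (e z) k)"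
      for i
      using le_if_bit[OF _ e[of z]] by (auto simp: field_at_def bit_take_bit_iff bit_drop_bit_eq)
    have "n < 2 ^ n" by (rule less_exp)
    then have "e v < 2 ^ Suc n" "field_at (e w) (e z) (e p) < 2 ^ Suc n"
      unfolding power_Suc using e[of v] e[of z] field_at_le[of "e w" "e z" "e p"] by linarith+
    then show ?thesis using eq_if_bits_eq bit_field by metis
  qed
qed

lemma ex_fields:
  assumes "\<And>i. i \<le> k \<Longrightarrow> f i < 2 ^ w"
  shows "\<exists>z::nat. z < 2 ^ ((k + 1) * w) \<and> (\<forall>i\<le>k. field_at w z (i * w) = f i)"
proof -
  define S where "S = {p. p < (k + 1) * w \<and> bit (f (p div w)) (p mod w)}"
  have "S \<subseteq> {..<(k + 1) * w}" by (auto simp: S_def)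
  then obtain z :: nat where z: "z < 2 ^ ((k + 1) * w)" "\<forall>i. bit z i \<longleftrightarrow> i \<in> S"
    using ex_bits by blast
  have "field_at w z (i * w) = f i" if "i \<le> k" for i
  proof (rule bit_eqI)
    fix t
    show "bit (field_at w z (i * w)) t \<longleftrightarrow> bit (f i) t"
    proof (cases "t < w")
      case True
      have "i * w + t < (i + 1) * w" using True by simp
      also have "\<dots> \<le> (k + 1) * w" using that by (intro mult_right_mono) auto
      finally have "i * w + t < (k + 1) * w" .
      with True show ?thesis
        using z(2) by (simp add: field_at_def bit_take_bit_iff bit_drop_bit_eq S_def)
    next
      case False
      then show ?thesis using not_bit_if_less_exp[OF assms[OF that], of t]
        by (simp add: field_at_def bit_take_bit_iff)
    qed
  qed
  with z(1) show ?thesis by blast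
qed

text \<open>A path of pairs of small numbers is stored in two numbers \<open>y\<close>, \<open>z\<close> as fields of
  width \<open>w\<close>, at the positions in the set coded by \<open>P\<close>.\<close>

definition path_code :: "nat \<Rightarrow> (nat \<Rightarrow> nat \<Rightarrow> nat \<Rightarrow> nat \<Rightarrow> bool) \<Rightarrow> nat \<Rightarrow> nat \<Rightarrow> nat \<Rightarrow> nat \<Rightarrow> bool"
  where
  "path_code n R j v j' v' \<longleftrightarrow> (\<exists>P\<le>n. \<exists>y\<le>n. \<exists>z\<le>n. \<exists>w\<le>n. \<exists>p\<le>n. \<exists>p'\<le>n.
     bit P p \<and> bit P p' \<and> p \<le> p' \<and> j = field_at w y p \<and> v = field_at w z p \<and>
     j' = field_at w y p' \<and> v' = field_at w z p' \<and>
     (\<forall>q\<le>n. \<forall>q'\<le>n. bit P q \<longrightarrow> bit P q' \<longrightarrow> p \<le> q \<longrightarrow> q < q' \<longrightarrow> q' \<le> p' \<longrightarrow>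
       (\<forall>s\<le>n. bit P s \<longrightarrow> \<not> (q < s \<and> s < q')) \<longrightarrow>
       (\<exists>a\<le>n. \<exists>b\<le>n. \<exists>a'\<le>n. \<exists>b'\<le>n. a = field_at w y q \<and> b = field_at w z q \<and>
         a' = field_at w y q' \<and> b' = field_at w z q' \<and> R a b a' b')))"

lemma definable_path_code:
  assumes "\<And>x a m i j k l. definable ell_Bit (\<lambda>n e. R n (e x) (e a) (e m) (e i) (e j) (e k) (e l))"
  shows "definable ell_Bit
    (\<lambda>n e. path_code n (R n (e x) (e a) (e m)) (e i) (e j) (e k) (e l))"
  unfolding path_code_def by (intro order_intros definable_field_at assms)

text \<open>Soundness for arbitrary guesses \<open>P\<close>, \<open>y\<close>, \<open>z\<close>,
  \<open>w\<close>: the induction follows the positions in \<open>P\<close>, with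
  \<open>Max A\<close> as the predecessor of \<open>q\<close>. Since \<open>R\<close> is arbitrary,
  the lemma also applies to nested paths.\<close>

lemma path_code_invariant:
  assumes "path_code n R j v j' v'" and "I j v"
    and R: "\<And>a b a' b'. R a b a' b' \<Longrightarrow> I a b \<Longrightarrow> I a' b'"
  shows "I j' v'"
proof -
  obtain P y z w p p' where bounds: "P \<le> n" "y \<le> n" "z \<le> n" "w \<le> n" "p \<le> n" "p' \<le> n"
    and Pp: "bit P p" "bit P p'" "p \<le> p'"
    and ends: "j = field_at w y p" "v = field_at w z p" "j' = field_at w y p'" "v' = field_at w z p'"
    and links: "\<forall>q\<le>n. \<forall>q'\<le>n. bit P q \<longrightarrow> bit P q' \<longrightarrow> p \<le> q \<longrightarrow> q < q' \<longrightarrow> q' \<le> p' \<longrightarrow>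
       (\<forall>s\<le>n. bit P s \<longrightarrow> \<not> (q < s \<and> s < q')) \<longrightarrow>
       (\<exists>a\<le>n. \<exists>b\<le>n. \<exists>a'\<le>n. \<exists>b'\<le>n. a = field_at w y q \<and> b = field_at w z q \<and>
         a' = field_at w y q' \<and> b' = field_at w z q' \<and> R a b a' b')"
    using assms(1) unfolding path_code_def by (elim exE conjE) (rule that; assumption)
  have step: "R (field_at w y q) (field_at w z q) (field_at w y q') (field_at w z q')"
    if "q \<le> n" "q' \<le> n" "bit P q" "bit P q'" "p \<le> q" "q < q'" "q' \<le> p'"
      "\<forall>s\<le>n. bit P s \<longrightarrow> \<not> (q < s \<and> s < q')" for q q'
    using links[rule_format, OF that(1-7)] that(8) by blast
  have "I (field_at w y q) (field_at w z q)" if "bit P q" "p \<le> q" "q \<le> p'" for q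
    using that
  proof (induction q rule: less_induct)
    case (less q)
    show ?case
    proof (cases "q = p")
      case True
      then show ?thesis using assms(2) ends by simp
    next
      case False
      define A where "A = {s. bit P s \<and> p \<le> s \<and> s < q}"
      have "finite A" by (rule finite_subset[of _ "{..<q}"]) (auto simp: A_def)
      moreover have "p \<in> A" using False less.prems Pp by (simp add: A_def)
      ultimately have "Max A \<in> A" and max: "\<And>s. s \<in> A \<Longrightarrow> s \<le> Max A" by (auto intro: Max_in)
      then have M: "bit P (Max A)" "p \<le> Max A" "Max A < q" by (simp_all add: A_def)
      have gap: "\<forall>s\<le>n. bit P s \<longrightarrow> \<not> (Max A < s \<and> s < q)"
      proof (intro allI impI notI)
        fix s assume "bit P s" "Max A < s \<and> s < q"
        then have "s \<in> A" using M by (simp add: A_def)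
        then show False using max[of s] \<open>Max A < s \<and> s < q\<close> by simp
      qed
      have "R (field_at w y (Max A)) (field_at w z (Max A)) (field_at w y q) (field_at w z q)"
        using less.prems M bounds by (intro step gap) auto
      moreover have "I (field_at w y (Max A)) (field_at w z (Max A))"
        using less.prems M by (intro less.IH) auto
      ultimately show ?thesis by (rule R)
    qed
  qed
  then show ?thesis using Pp ends by simp
qed

text \<open>The fields are stored at the multiples of \<open>w\<close>. Multiplication is not yet
  definable, so the set \<open>P\<close> of these positions is guessed too, and the next field is
  found by the order alone.\<close>

lemma path_code_complete:
  assumes "\<And>i. i < k \<Longrightarrow> R (f i) (g i) (f (Suc i)) (g (Suc i))"
    and "\<And>i. i \<le> k \<Longrightarrow> f i < 2 ^ w" "\<And>i. i \<le> k \<Longrightarrow> g i < 2 ^ w"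
    and n: "2 ^ ((k + 1) * w) \<le> n" and "0 < w"
  shows "path_code n R (f 0) (g 0) (f k) (g k)"
proof -
  obtain y where y: "y < 2 ^ ((k + 1) * w)" "\<And>i. i \<le> k \<Longrightarrow> field_at w y (i * w) = f i"
    using ex_fields[of k f w] assms(2) by blast
  obtain z where z: "z < 2 ^ ((k + 1) * w)" "\<And>i. i \<le> k \<Longrightarrow> field_at w z (i * w) = g i"
    using ex_fields[of k g w] assms(3) by blast
  have lt: "i * w < (k + 1) * w" if "i \<le> k" for i
    using that \<open>0 < w\<close> by (intro mult_strict_right_mono) auto
  then have "(\<lambda>i. i * w) ` {..k} \<subseteq> {..<(k + 1) * w}" by blast
  then obtain P :: nat where P: "P < 2 ^ ((k + 1) * w)" "\<forall>i. bit P i \<longleftrightarrow> i \<in> (\<lambda>i. i * w) ` {..k}"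
    using ex_bits by blast
  have "(k + 1) * w \<le> n" using less_exp[of "(k + 1) * w"] n by linarith
  then have le: "i * w \<le> n" if "i \<le> k" for i using lt[OF that] by linarith
  have "w \<le> (k + 1) * w" by simp
  then have "w \<le> n" using \<open>(k + 1) * w \<le> n\<close> by (rule order_trans)
  have bounds: "P \<le> n" "y \<le> n" "z \<le> n" using P y z n by linarith+
  have step: "\<exists>a\<le>n. \<exists>b\<le>n. \<exists>a'\<le>n. \<exists>b'\<le>n. a = field_at w y q \<and> b = field_at w z q \<and>
         a' = field_at w y q' \<and> b' = field_at w z q' \<and> R a b a' b'"
    if Pq: "bit P q" "bit P q'" and "q < q'" and gap: "\<forall>s\<le>n. bit P s \<longrightarrow> \<not> (q < s \<and> s < q')" for q q'
  proof -
    obtain i i' where i: "q = i * w" "i \<le> k" "q' = i' * w" "i' \<le> k"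
      using Pq P(2) by auto
    have "i < i'" using \<open>q < q'\<close> i by simp
    have "i' = Suc i"
    proof (rule ccontr)
      assume "i' \<noteq> Suc i"
      then have "Suc i < i'" using \<open>i < i'\<close> by simp
      then have "q < Suc i * w" "Suc i * w < q'" "Suc i \<le> k"
        using i \<open>0 < w\<close> by (auto intro!: mult_strict_right_mono simp del: mult_Suc)
      moreover have "bit P (Suc i * w)" using P(2) \<open>Suc i \<le> k\<close> by blast
      ultimately show False using gap le by blast
    qed
    then have "R (field_at w y q) (field_at w z q) (field_at w y q') (field_at w z q')"
      using assms(1)[of i] y(2) z(2) i by (simp del: mult_Suc)
    then show ?thesis using field_at_le bounds by (meson order_trans)
  qed
  have "bit P 0" "bit P (k * w)" using P(2) by force+
  moreover have "f 0 = field_at w y 0" "g 0 = field_at w z 0"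
    "f k = field_at w y (k * w)" "g k = field_at w z (k * w)"
    using y(2)[of 0] y(2)[of k] z(2)[of 0] z(2)[of k] by simp_all
  ultimately have main: "bit P 0 \<and> bit P (k * w) \<and> 0 \<le> k * w \<and> f 0 = field_at w y 0 \<and>
     g 0 = field_at w z 0 \<and> f k = field_at w y (k * w) \<and> g k = field_at w z (k * w) \<and>
     (\<forall>q\<le>n. \<forall>q'\<le>n. bit P q \<longrightarrow> bit P q' \<longrightarrow> 0 \<le> q \<longrightarrow> q < q' \<longrightarrow> q' \<le> k * w \<longrightarrow>
       (\<forall>s\<le>n. bit P s \<longrightarrow> \<not> (q < s \<and> s < q')) \<longrightarrow>
       (\<exists>a\<le>n. \<exists>b\<le>n. \<exists>a'\<le>n. \<exists>b'\<le>n. a = field_at w y q \<and> b = field_at w z q \<and>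
         a' = field_at w y q' \<and> b' = field_at w z q' \<and> R a b a' b'))"
    using step by simp
  show ?thesis
    unfolding path_code_def
    by (rule exI[of _ P], rule conjI[OF bounds(1)], rule exI[of _ y], rule conjI[OF bounds(2)],
        rule exI[of _ z], rule conjI[OF bounds(3)], rule exI[of _ w], rule conjI[OF \<open>w \<le> n\<close>],
        rule exI[of _ 0], rule conjI[OF le0], rule exI[of _ "k * w"], rule conjI[OF le[OF order_refl]],
        rule main)
qed

text \<open>The states \<open>(j, v)\<close> of the run satisfy \<open>v = a * (x div 2 ^ j) mod m\<close>.\<close>

definition horner_step :: "nat \<Rightarrow> nat \<Rightarrow> nat \<Rightarrow> nat \<Rightarrow> nat \<Rightarrow> nat \<Rightarrow> nat \<Rightarrow> nat \<Rightarrow> bool" where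
  "horner_step n x a m j v j' v' \<longleftrightarrow> j = Suc j' \<and> v' < m \<and> (\<exists>s\<le>n. \<exists>t\<le>n.
     v + v = s \<and> (bit x j' \<longrightarrow> s + a = t) \<and> (\<not> bit x j' \<longrightarrow> s = t) \<and>
     (t = v' \<or> v' + m = t \<or> (\<exists>u\<le>n. v' + m = u \<and> u + m = t)))"

text \<open>As all bits of \<open>x\<close> lie below \<open>J\<close>,
  \<open>x div 2 ^ J = 0\<close>, so the run leads from \<open>(J, 0)\<close> to
  \<open>(0, r)\<close>. The variable \<open>o'\<close> names the constant 0.\<close>

definition residue :: "nat \<Rightarrow> nat \<Rightarrow> nat \<Rightarrow> nat \<Rightarrow> nat \<Rightarrow> bool" where
  "residue n x a m r \<longleftrightarrow> r < m \<and> (\<exists>J\<le>n. \<exists>o'\<le>n. o' = 0 \<and> (\<forall>i. bit x i \<longrightarrow> i < J) \<and>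
     path_code n (path_code n (horner_step n x a m)) J o' o' r)"

lemma definable_residue: "definable ell_Bit (\<lambda>n e. residue n (e x) (e a) (e m) (e r))"
proof -
  have "definable ell_Bit
      (\<lambda>n e. horner_step n (e x) (e a) (e m) (e i) (e j) (e k) (e l))" for x a m i j k l
    unfolding horner_step_def by (intro order_intros definable_add)
  then have "definable ell_Bit
      (\<lambda>n e. path_code n (horner_step n (e x) (e a) (e m)) (e i) (e j) (e k) (e l))" for x a m i j k l
    by (rule definable_path_code)
  then have "definable ell_Bit
      (\<lambda>n e. path_code n (path_code n (horner_step n (e x) (e a) (e m))) (e i) (e j) (e k) (e l))"
    for x a m i j k l
    by (rule definable_path_code)
  then show ?thesis unfolding residue_def by (intro order_intros)
qed

section \<open>Correctness of the nested Horner runs\<close>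

lemma div_exp_eq_horner: "x div 2 ^ j = 2 * (x div 2 ^ Suc j) + of_bool (bit x j)" for x :: nat
proof -
  have "x div 2 ^ Suc j = x div 2 ^ j div 2"
    by (simp flip: div_mult2_eq add: mult.commute)
  then show ?thesis by (simp add: bit_iff_odd)
qed

lemma horner_step_mod:
  assumes "horner_step n x a m j v j' v'" and "v mod m = a * (x div 2 ^ j) mod m"
  shows "v' mod m = a * (x div 2 ^ j') mod m"
proof -
  have "v' mod m = (2 * v + of_bool (bit x j') * a) mod m"
    using assms(1) by (auto simp: horner_step_def mult_2)
  also have "\<dots> = (2 * (a * (x div 2 ^ j)) + of_bool (bit x j') * a) mod m"
    by (rule mod_add_cong[OF mod_mult_cong[OF refl assms(2)] refl])
  also have "2 * (a * (x div 2 ^ j)) + of_bool (bit x j') * a = a * (x div 2 ^ j')"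
    using assms(1) unfolding horner_step_def div_exp_eq_horner[of x j'] by (simp add: algebra_simps)
  finally show ?thesis .
qed

text \<open>The congruence survives a single step, hence an inner path, hence the outer path: the
  invariant lemma is applied twice.\<close>

lemma residue_eq:
  assumes "residue n x a m r"
  shows "r = a * x mod m"
proof -
  obtain J where r: "r < m" and J: "\<And>i. bit x i \<Longrightarrow> i < J"
    and path: "path_code n (path_code n (horner_step n x a m)) J 0 0 r"
    using assms unfolding residue_def by auto
  define I where "I j v \<longleftrightarrow> v mod m = a * (x div 2 ^ j) mod m" for j v
  have "I j' v'" if "horner_step n x a m j v j' v'" "I j v" for j v j' v'
    using horner_step_mod that unfolding I_def by blast
  then have "I j' v'" if "path_code n (horner_step n x a m) j v j' v'" "I j v" for j v j' v'
    using path_code_invariant[of n _ j v j' v' I] that by blast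
  moreover have "x < 2 ^ J" by (rule less_exp_if_not_bit) (use J in force)
  then have "I J 0" by (simp add: I_def)
  ultimately have "I 0 r" using path_code_invariant[OF path, of I] by blast
  with r show ?thesis by (simp add: I_def)
qed

text \<open>From \<open>v, a < m\<close>, doubling and adding stays below \<open>3 * m\<close>; so
  at most two subtractions of \<open>m\<close> reduce the result, and \<open>3 * m \<le> n\<close>
  keeps the sums in the universe.\<close>

lemma horner_step_run:
  assumes "i < J" "a < m" "3 * m \<le> n"
  shows "horner_step n x a m (J - i) (a * (x div 2 ^ (J - i)) mod m)
    (J - Suc i) (a * (x div 2 ^ (J - Suc i)) mod m)"
proof -
  define v where "v = a * (x div 2 ^ (J - i)) mod m"
  define b where "b = bit x (J - Suc i)"
  define t where "t = v + v + of_bool b * a"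
  have J: "J - i = Suc (J - Suc i)" using assms(1) by simp
  have v: "v < m" unfolding v_def using assms(2) by simp
  have "a * (x div 2 ^ (J - Suc i)) mod m = (2 * (a * (x div 2 ^ (J - i))) + of_bool b * a) mod m"
    unfolding div_exp_eq_horner[of x "J - Suc i"] J b_def by (simp add: algebra_simps)
  also have "\<dots> = t mod m"
    unfolding t_def mult_2[symmetric]
    by (rule mod_add_cong[OF mod_mult_cong[OF refl] refl]) (simp add: v_def)
  finally have eq: "a * (x div 2 ^ (J - Suc i)) mod m = t mod m" .
  have t: "t < 3 * m" unfolding t_def using v assms(2) by (cases b) auto
  have "t = t mod m \<or> t mod m + m = t \<or> t mod m + m + m = t"
  proof -
    have "t div m < 3" using t by (simp add: less_mult_imp_div_less)
    then have "t div m = 0 \<or> t div m = 1 \<or> t div m = 2" by linarith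
    moreover have "t = s \<or> s + m = t \<or> s + m + m = t" if "t = s + m * q" "q = 0 \<or> q = 1 \<or> q = 2"
      for s q
      using that by auto
    ultimately show ?thesis using mod_mult_div_eq[of t m] by metis
  qed
  then show ?thesis
    unfolding horner_step_def eq v_def[symmetric]
    using J assms t v by (auto simp: t_def b_def[symmetric])
qed

lemma residue_complete:
  assumes "x < 2 ^ J" "a < m" "m < 2 ^ w" "J < 2 ^ w" "J \<le> k * k" "0 < w" "0 < k"
    and n: "2 ^ ((k + 1) * w) \<le> n"
  shows "residue n x a m (a * x mod m)"
proof -
  define f g where "f i = J - i" and "g i = a * (x div 2 ^ (J - i)) mod m" for i
  have fg: "f i < 2 ^ w" "g i < 2 ^ w" for i
    using assms by (auto simp: f_def g_def intro: le_less_trans[OF diff_le_self] less_trans[OF mod_less_divisor])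
  have le_n: "2 ^ ((l + 1) * w) \<le> n" if "l \<le> k" for l
  proof -
    have "(2::nat) ^ ((l + 1) * w) \<le> 2 ^ ((k + 1) * w)"
      using that by (intro power_increasing mult_right_mono) auto
    then show ?thesis using n by linarith
  qed
  have sq: "(2::nat) ^ w * 2 ^ w \<le> n" using le_n[of 1] \<open>0 < k\<close> by (simp add: mult_2 power_add)
  obtain h where h: "(2::nat) ^ w = Suc h" using not0_implies_Suc[of "2 ^ w"] by auto
  have "3 * m \<le> 3 * h" using assms(3) h by simp
  also have "\<dots> \<le> Suc h * Suc h" by (simp add: le_SucI)
  finally have "3 * m \<le> n" using sq h by simp
  have step: "path_code n (horner_step n x a m) (f i) (g i) (f (i + l)) (g (i + l))"
    if "i + l \<le> J" "l \<le> k" for i l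
  proof -
    have "path_code n (horner_step n x a m) (f (i + 0)) (g (i + 0)) (f (i + l)) (g (i + l))"
    proof (rule path_code_complete[where w = w])
      show "horner_step n x a m (f (i + h)) (g (i + h)) (f (i + Suc h)) (g (i + Suc h))" if "h < l" for h
        using horner_step_run[of "i + h" J a m n x] that \<open>i + l \<le> J\<close> assms(2) \<open>3 * m \<le> n\<close>
        by (simp add: f_def g_def)
    qed (use fg le_n[OF that(2)] assms in auto)
    then show ?thesis by simp
  qed
  \<comment> \<open>Block boundaries for \<open>k\<close> blocks of at most \<open>k\<close> steps;
    truncation at \<open>J\<close> may leave short or empty blocks at the end.\<close>
  define h where "h i = min (i * k) J" for i
  have "path_code n (path_code n (horner_step n x a m)) (f (h 0)) (g (h 0)) (f (h k)) (g (h k))"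
  proof (rule path_code_complete[where w = w])
    show "path_code n (horner_step n x a m) (f (h i)) (g (h i)) (f (h (Suc i))) (g (h (Suc i)))"
      if "i < k" for i
    proof -
      have "h i \<le> h (Suc i)" "h (Suc i) \<le> h i + k" "h (Suc i) \<le> J" by (auto simp: h_def)
      then show ?thesis using step[of "h i" "h (Suc i) - h i"] by simp
    qed
  qed (use fg n assms in auto)
  moreover have "f (h 0) = J" "g (h 0) = 0" "f (h k) = 0" "g (h k) = a * x mod m"
    using assms by (simp_all add: f_def g_def h_def)
  moreover have "J \<le> n" using assms(4) sq h by simp
  moreover have "i < J" if "bit x i" for i
    using not_bit_if_less_exp[OF assms(1)] that not_less by blast
  ultimately show ?thesis using assms(2) unfolding residue_def by auto
qed

lemma exp_gt_square: "15 \<le> t \<Longrightarrow> 4 * (t + 1) * (t + 1) + 8 < (2::nat) ^ (t - 3)"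
proof (induction t rule: dec_induct)
  case base
  then show ?case by simp
next
  case (step t)
  have "4 * (Suc t + 1) * (Suc t + 1) + 8 \<le> 2 * (4 * (t + 1) * (t + 1) + 8)"
    using step.hyps by (simp add: algebra_simps)
  also have "\<dots> < 2 * 2 ^ (t - 3)" using step.IH by simp
  also have "\<dots> = 2 ^ (Suc t - 3)" using step.hyps by (simp add: Suc_diff_le flip: power_Suc)
  finally show ?case .
qed

text \<open>Let \<open>l\<close> and \<open>t\<close> be the integer parts of the binary logarithm
  of \<open>n\<close> and of the root of \<open>l\<close>. The choice is \<open>J = l + 1\<close>,
  \<open>k = t + 1\<close>, \<open>w = t - 3\<close>, so that
  \<open>(k + 1) * w = (t + 2) * (t - 3) \<le> t * t \<le> l\<close>. Fields must hold moduli up to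
  \<open>4 * J\<close>, the bound for testing equality below \<open>2 ^ (2 * J)\<close>; this is
  secured from \<open>t = 15\<close> on, whence \<open>225 = 15 * 15\<close>.\<close>

lemma ex_path_parameters:
  assumes "2 ^ 225 \<le> (n::nat)"
  shows "\<exists>J w k. n < 2 ^ J \<and> 4 * J < 2 ^ w \<and> J \<le> k * k \<and> 0 < w \<and> 0 < k \<and> 2 ^ ((k + 1) * w) \<le> n"
proof -
  obtain l where l: "2 ^ l \<le> n" "n < 2 ^ (l + 1)"
    using ex_power_ivl1[of 2 n] assms by auto
  have "(2::nat) ^ 225 < 2 ^ (l + 1)" using assms l(2) by (rule le_less_trans)
  then have "225 < l + 1" by (rule power_less_imp_less_exp[rotated]) simp
  then have "225 \<le> l" by simp
  define t where "t = Max {t. t * t \<le> l}"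
  have fin: "finite {t. t * t \<le> l}"
    by (rule finite_subset[of _ "{..l}"]) (auto intro: order_trans[OF le_square])
  have "0 \<in> {t. t * t \<le> l}" by simp
  then have "t \<in> {t. t * t \<le> l}" unfolding t_def by (intro Max_in[OF fin]) blast
  then have t: "t * t \<le> l" by simp
  have "15 \<le> t" unfolding t_def using fin \<open>225 \<le> l\<close> by (intro Max_ge) auto
  have t1: "l < (t + 1) * (t + 1)"
  proof (rule ccontr)
    assume "\<not> ?thesis"
    then have "t + 1 \<le> t" unfolding t_def using fin by (intro Max_ge) auto
    then show False by simp
  qed
  have "(t + 1 + 1) * (t - 3) \<le> l"
  proof -
    obtain d where "t = d + 3" using \<open>15 \<le> t\<close> that[of "t - 3"] by simp
    then have "(t + 1 + 1) * (t - 3) \<le> t * t" by (simp add: algebra_simps)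
    with t show ?thesis by linarith
  qed
  then have "(2::nat) ^ ((t + 1 + 1) * (t - 3)) \<le> 2 ^ l" by (intro power_increasing) simp_all
  then have "(2::nat) ^ ((t + 1 + 1) * (t - 3)) \<le> n" using l(1) by linarith
  moreover have "4 * (l + 1) < 2 ^ (t - 3)"
    using exp_gt_square[OF \<open>15 \<le> t\<close>] t1 by (simp add: algebra_simps)
  ultimately show ?thesis
    using l(2) t1 \<open>15 \<le> t\<close> by (intro exI[of _ "l + 1"] exI[of _ "t - 3"] exI[of _ "t + 1"]) auto
qed

text \<open>A product is checked modulo all numbers up to \<open>O(log n)\<close>, whose least common multiple
  exceeds \<open>n ^ 2\<close>.\<close>

lemma definable_mult: "definable ell_Bit (\<lambda>n e. e i * e j = e k)"
proof (rule Bit.definable_if_eventually)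
  \<comment> \<open>Multiplier 1 reduces a number modulo \<open>m\<close>. The factor
    \<open>e j\<close> is reduced beforehand because runs are only guaranteed for multipliers below
    \<open>m\<close>; a modulus without runs imposes no condition.\<close>
  show "definable ell_Bit (\<lambda>n e. \<exists>u\<le>n. u = 1 \<and> (\<forall>m\<le>n. \<forall>a\<le>n. \<forall>r\<le>n. \<forall>s\<le>n.
    residue n (e j) u m a \<longrightarrow> residue n (e i) a m r \<longrightarrow> residue n (e k) u m s \<longrightarrow> r = s))"
    by (intro order_intros definable_residue)
  show "(\<exists>u\<le>n. u = 1 \<and> (\<forall>m\<le>n. \<forall>a\<le>n. \<forall>r\<le>n. \<forall>s\<le>n.
    residue n (e j) u m a \<longrightarrow> residue n (e i) a m r \<longrightarrow> residue n (e k) u m s \<longrightarrow> r = s))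
    = (e i * e j = e k)" (is "?lhs = _") if n: "2 ^ 225 \<le> n" and e: "\<And>x. e x \<le> n" for n e
  proof
    assume ?lhs
    then have *: "r = s" if "m \<le> n" "a \<le> n" "r \<le> n" "s \<le> n" "residue n (e j) 1 m a"
      "residue n (e i) a m r" "residue n (e k) 1 m s" for m a r s
      using that by blast
    obtain J w l where J: "n < 2 ^ J" "4 * J < 2 ^ w" "J \<le> l * l" "0 < w" "0 < l"
      "2 ^ ((l + 1) * w) \<le> n"
      using ex_path_parameters[OF n] by blast
    have lt: "e x < 2 ^ J" for x using e[of x] J(1) by (rule le_less_trans)
    have "e i * e j < 2 ^ J * 2 ^ J" using lt by (intro mult_strict_mono) auto
    also have "\<dots> = 2 ^ (2 * J)" by (simp add: mult_2 power_add)
    finally have 1: "e i * e j < 2 ^ (2 * J)" .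
    have 2: "e k < 2 ^ (2 * J)"
      by (rule less_le_trans[OF lt[of k]]) (simp add: power_increasing)
    show "e i * e j = e k"
    proof (rule eq_if_mod_eq[OF 1 2])
      fix m assume m: "2 \<le> m" "m \<le> 2 * (2 * J)"
      have res: "residue n (e x) a m (a * e x mod m)" if "a < m" for x a
        by (rule residue_complete[where J = J and w = w and k = l]) (use J m that lt in auto)
      have "w \<le> (l + 1) * w" by simp
      then have "(2::nat) ^ w \<le> 2 ^ ((l + 1) * w)" by (intro power_increasing) simp_all
      then have "m \<le> n" using m J by linarith
      moreover have lt_n: "y mod m \<le> n" for y
        using \<open>m \<le> n\<close> m(1) mod_less_divisor[of m y] by linarith
      ultimately have "(e j mod m) * e i mod m = e k mod m"
        using res[of 1 j] res[of "e j mod m" i] res[of 1 k] m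
        by (intro *[OF \<open>m \<le> n\<close> lt_n lt_n lt_n]) auto
      then show "e i * e j mod m = e k mod m" by (simp add: mod_mult_right_eq mult.commute)
    qed
  next
    assume eq: "e i * e j = e k"
    have "1 \<le> (2::nat) ^ 225" by simp
    then have "1 \<le> n" using n by (rule order_trans)
    moreover have "r = s" if "residue n (e j) 1 m a" "residue n (e i) a m r" "residue n (e k) 1 m s"
      for m a r s
      using that[THEN residue_eq] eq by (simp add: mod_mult_right_eq mult.commute)
    ultimately show ?lhs by blast
  qed
qed

section \<open>Rows and columns\<close>

lemma tri_0 [simp]: "tri 0 = 0"
  by (simp add: tri_def)

lemma tri_Suc: "tri (Suc i) = tri i + Suc i"
proof -
  have "Suc i * (Suc i + 1) = i * (i + 1) + 2 * Suc i" by simp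
  then show ?thesis unfolding tri_def by simp
qed

lemma two_times_tri: "2 * tri i = i * (i + 1)"
  by (induction i) (simp_all add: tri_Suc algebra_simps)

lemma le_tri: "i \<le> tri i"
  by (induction i) (simp_all add: tri_Suc)

lemma Suc_le_tri: "2 \<le> i \<Longrightarrow> Suc i \<le> tri i"
  by (induction i rule: dec_induct) (simp_all add: tri_Suc eval_nat_numeral)

lemma strict_mono_tri: "strict_mono tri"
  by (simp add: strict_mono_Suc_iff tri_Suc)

lemmas tri_le_iff [simp] = strict_mono_less_eq[OF strict_mono_tri]
lemmas tri_less_iff [simp] = strict_mono_less[OF strict_mono_tri]
lemmas tri_eq_iff [simp] = strict_mono_eq[OF strict_mono_tri]

lemma col_eqI: "tri c \<le> x \<Longrightarrow> x < tri (Suc c) \<Longrightarrow> col x = c"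
  unfolding col_def by (rule Greatest_equality) (auto simp: not_less_eq_eq[symmetric] dest: le_less_trans)

lemma tri_col_le: "tri (col x) \<le> x"
  unfolding col_def by (rule GreatestI_nat[of _ 0 x]) (auto intro: order_trans[OF le_tri])

lemma le_col: "tri c \<le> x \<Longrightarrow> c \<le> col x"
  unfolding col_def by (rule Greatest_le_nat[of _ _ x]) (auto intro: order_trans[OF le_tri])

lemma less_tri_Suc_col: "x < tri (Suc (col x))"
  using le_col[of "Suc (col x)" x] by (meson not_less not_less_eq_eq order_refl)

lemma tri_plus_row: "tri (col x) + row x = x"
  using tri_col_le[of x] by (simp add: row_def qq_def)

lemma row_le_col: "row x \<le> col x"
  using tri_plus_row[of x] less_tri_Suc_col[of x] by (simp add: tri_Suc)

lemma col_tri_plus [simp]: "r \<le> c \<Longrightarrow> col (tri c + r) = c"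
  by (rule col_eqI) (simp_all add: tri_Suc)

lemma row_tri_plus [simp]: "r \<le> c \<Longrightarrow> row (tri c + r) = r"
  by (simp add: row_def qq_def)

lemma col_le: "col x \<le> x"
  using le_tri[of "col x"] tri_col_le[of x] by linarith

lemma row_le: "row x \<le> x"
  by (simp add: row_def)

text \<open>Provides \<open>Suc (col x)\<close> as an element of the universe. It fails for 0 and 1,
  which therefore need care in the definitions of C and Q.\<close>

lemma Suc_col_le:
  assumes "2 \<le> x"
  shows "Suc (col x) \<le> x"
proof (cases "2 \<le> col x")
  case True
  then show ?thesis using Suc_le_tri[OF True] tri_col_le[of x] by linarith
next
  case False
  then show ?thesis using assms by simp
qed

section \<open>Triangular numbers, columns and rows from Bit\<close>

text \<open>The product \<open>i * (i + 1)\<close> may exceed \<open>n\<close>, so the even factor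
  is halved first. For \<open>i \<ge> 2\<close> the successor is at most \<open>tri i\<close>; for 0
  and 1 it may be missing, hence the explicit cases.\<close>

lemma definable_tri: "definable ell_Bit (\<lambda>n e. tri (e i) = e j)"
proof (rule definable_cong)
  show "definable ell_Bit (\<lambda>n e. (e i = 0 \<and> e j = 0) \<or> (e i = 1 \<and> e j = 1) \<or>
    (\<exists>d\<le>n. \<exists>h\<le>n. d = Suc (e i) \<and> ((h + h = e i \<and> h * d = e j) \<or> (h + h = d \<and> e i * h = e j))))"
    by (intro order_intros definable_add definable_mult)
  show "((e i = 0 \<and> e j = 0) \<or> (e i = 1 \<and> e j = 1) \<or>
    (\<exists>d\<le>n. \<exists>h\<le>n. d = Suc (e i) \<and> ((h + h = e i \<and> h * d = e j) \<or> (h + h = d \<and> e i * h = e j))))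
    = (tri (e i) = e j)" (is "?lhs = _") if e: "\<And>x. e x \<le> n" for n e
  proof
    assume ?lhs
    then consider "e i = e j" "e i = 0 \<or> e i = 1"
      | h where "h + h = e i" "h * Suc (e i) = e j" | h where "h + h = Suc (e i)" "e i * h = e j"
      by auto
    then have "2 * tri (e i) = 2 * e j"
    proof cases
      case 1
      then show ?thesis by (auto simp: tri_def)
    next
      case (2 h)
      have "e i * (e i + 1) = (h + h) * Suc (e i)" using 2(1) by simp
      also have "\<dots> = 2 * e j" unfolding 2(2)[symmetric] by simp
      finally show ?thesis unfolding two_times_tri .
    next
      case (3 h)
      have "e i * (e i + 1) = e i * (h + h)" using 3(1) by simp
      also have "\<dots> = 2 * e j" unfolding 3(2)[symmetric] by simp
      finally show ?thesis unfolding two_times_tri .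
    qed
    then show "tri (e i) = e j" by simp
  next
    assume tri: "tri (e i) = e j"
    show ?lhs
    proof (cases "2 \<le> e i")
      case True
      have "Suc (e i) \<le> n" using Suc_le_tri[OF True] tri e[of j] by simp
      have "2 * e j = e i * Suc (e i)" using two_times_tri[of "e i"] tri by simp
      show ?thesis
      proof (cases "even (e i)")
        case True
        then obtain h where h: "e i = h + h" by (metis evenE mult_2)
        have "2 * e j = 2 * (h * Suc (e i))"
          unfolding \<open>2 * e j = e i * Suc (e i)\<close> by (subst h) simp
        then have "h * Suc (e i) = e j" "h \<le> n" using h \<open>Suc (e i) \<le> n\<close> by simp_all
        then show ?thesis using h \<open>Suc (e i) \<le> n\<close> by metis
      next
        case False
        then obtain h where h: "Suc (e i) = h + h" by (metis evenE mult_2 even_Suc)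
        have "2 * e j = 2 * (e i * h)"
          unfolding \<open>2 * e j = e i * Suc (e i)\<close> by (subst h) simp
        then have "e i * h = e j" "h \<le> n" using h \<open>Suc (e i) \<le> n\<close> by simp_all
        then show ?thesis using h \<open>Suc (e i) \<le> n\<close> by metis
      qed
    next
      case False
      then have "e i = 0 \<or> e i = 1" by auto
      then show ?thesis using tri by (auto simp: tri_def)
    qed
  qed
qed

lemma definable_col: "definable ell_Bit (\<lambda>n e. col (e i) = e j)"
proof (rule definable_cong)
  show "definable ell_Bit (\<lambda>n e. \<exists>q\<le>n. tri (e j) = q \<and> q \<le> e i \<and>
    \<not> (\<exists>c\<le>n. \<exists>p\<le>n. e j < c \<and> tri c = p \<and> p \<le> e i))"
    by (intro order_intros definable_tri)
  show "(\<exists>q\<le>n. tri (e j) = q \<and> q \<le> e i \<and> \<not> (\<exists>c\<le>n. \<exists>p\<le>n. e j < c \<and> tri c = p \<and> p \<le> e i))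
    = (col (e i) = e j)" (is "?lhs = _") if e: "\<And>x. e x \<le> n" for n e
  proof
    assume ?lhs
    then have *: "tri (e j) \<le> e i" "\<And>c. c \<le> n \<Longrightarrow> tri c \<le> n \<Longrightarrow> e j < c \<Longrightarrow> \<not> tri c \<le> e i" by auto
    moreover have "e i < tri (Suc (e j))"
    proof (rule ccontr)
      assume "\<not> ?thesis"
      then have "tri (Suc (e j)) \<le> n" "tri (Suc (e j)) \<le> e i" using e[of i] by simp_all
      moreover have "Suc (e j) \<le> tri (Suc (e j))" by (rule le_tri)
      ultimately show False using *(2)[of "Suc (e j)"] by simp
    qed
    ultimately show "col (e i) = e j" by (intro col_eqI)
  next
    assume "col (e i) = e j"
    then have "tri (e j) \<le> e i" "e i < tri (Suc (e j))"
      using tri_col_le[of "e i"] less_tri_Suc_col[of "e i"] by simp_all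
    moreover have "\<not> tri c \<le> e i" if "e j < c" for c
    proof -
      have "tri (Suc (e j)) \<le> tri c" using that by simp
      then show ?thesis using \<open>e i < tri (Suc (e j))\<close> by linarith
    qed
    ultimately show ?lhs using e[of i] by (meson order_trans)
  qed
qed

lemma definable_row: "definable ell_Bit (\<lambda>n e. row (e i) = e j)"
proof (rule definable_cong)
  show "definable ell_Bit (\<lambda>n e. \<exists>c\<le>n. \<exists>q\<le>n. col (e i) = c \<and> tri c = q \<and> q + e j = e i)"
    by (intro order_intros definable_tri definable_col definable_add)
  show "(\<exists>c\<le>n. \<exists>q\<le>n. col (e i) = c \<and> tri c = q \<and> q + e j = e i) = (row (e i) = e j)"
    (is "?lhs = _") if e: "\<And>x. e x \<le> n" for n e
  proof -
    have "col (e i) \<le> n" "tri (col (e i)) \<le> n"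
      using e[of i] col_le[of "e i"] tri_col_le[of "e i"] by linarith+
    then have "?lhs \<longleftrightarrow> tri (col (e i)) + e j = e i" by auto
    also have "\<dots> \<longleftrightarrow> row (e i) = e j" using tri_plus_row[of "e i"] by linarith
    finally show ?thesis .
  qed
qed

lemma definable_lhd: "definable ell_Bit (\<lambda>n e. lhd (e i) (e j))"
proof (rule definable_cong)
  show "definable ell_Bit (\<lambda>n e. \<exists>r\<le>n. \<exists>s\<le>n. \<exists>c\<le>n. \<exists>d\<le>n. row (e i) = r \<and> row (e j) = s \<and>
    col (e i) = c \<and> col (e j) = d \<and> (r < s \<or> r = s \<and> c < d))"
    by (intro order_intros definable_row definable_col)
  show "(\<exists>r\<le>n. \<exists>s\<le>n. \<exists>c\<le>n. \<exists>d\<le>n. row (e i) = r \<and> row (e j) = s \<and>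
    col (e i) = c \<and> col (e j) = d \<and> (r < s \<or> r = s \<and> c < d)) = lhd (e i) (e j)"
    if "\<And>x. e x \<le> n" for n e
    using order_trans[OF row_le that] order_trans[OF col_le that] by (auto simp: lhd_def)
qed

text \<open>At 0 the number \<open>c + 1 = 1\<close> may lie outside the universe although its bit 0
  is set, hence the extra disjunct. At 1 the number 2 may be missing, but its bit 0 is not set, so
  the failing witness gives the right answer.\<close>

lemma definable_Cset: "definable ell_Bit (\<lambda>n e. e i \<in> Cset)"
proof (rule definable_cong)
  show "definable ell_Bit (\<lambda>n e. e i = 0 \<or> (\<exists>r\<le>n. \<exists>c\<le>n. \<exists>d\<le>n.
    row (e i) = r \<and> col (e i) = c \<and> d = Suc c \<and> bit d r))"
    by (intro order_intros definable_row definable_col)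
  show "(e i = 0 \<or> (\<exists>r\<le>n. \<exists>c\<le>n. \<exists>d\<le>n. row (e i) = r \<and> col (e i) = c \<and> d = Suc c \<and> bit d r))
    = (e i \<in> Cset)" (is "?lhs = _") if e: "\<And>x. e x \<le> n" for n e
  proof -
    have Cset: "e i \<in> Cset \<longleftrightarrow> bit (Suc (col (e i))) (row (e i))"
      by (simp add: Cset_def bit_iff_odd)
    consider "e i = 0" | "e i = 1" | "2 \<le> e i" by linarith
    then show ?thesis
    proof cases
      case 1
      have "col 0 = 0" "row 0 = 0" using col_tri_plus[of 0 0] row_tri_plus[of 0 0] by simp_all
      then show ?thesis using 1 Cset by (simp add: bit_iff_odd)
    next
      case 2
      have "col 1 = 1" "row 1 = 0" using col_tri_plus[of 0 1] row_tri_plus[of 0 1] by (simp_all add: tri_def)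
      then show ?thesis using 2 Cset by (auto simp: bit_iff_odd)
    next
      case 3
      then have "Suc (col (e i)) \<le> n" "row (e i) \<le> n"
        using Suc_col_le[OF 3] row_le[of "e i"] e[of i] by linarith+
      then show ?thesis using 3 unfolding Cset by auto
    qed
  qed
qed

text \<open>The number \<open>tri (c + 1)\<close> can exceed \<open>n\<close>; only a bit of the sum
  \<open>tri c + (c + 1)\<close> is taken. At 0 and 1 the relevant bits, those at position 0 of 1
  and 3, are set.\<close>

lemma definable_Qset: "definable ell_Bit (\<lambda>n e. e i \<in> Qset)"
proof (rule definable_cong)
  show "definable ell_Bit (\<lambda>n e. e i = 0 \<or> e i = 1 \<or> (\<exists>r\<le>n. \<exists>c\<le>n. \<exists>d\<le>n. \<exists>q\<le>n.
    row (e i) = r \<and> col (e i) = c \<and> d = Suc c \<and> tri c = q \<and> bit (q + d) r))"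
    by (intro order_intros definable_row definable_col definable_tri definable_bit_add)
  show "(e i = 0 \<or> e i = 1 \<or> (\<exists>r\<le>n. \<exists>c\<le>n. \<exists>d\<le>n. \<exists>q\<le>n.
    row (e i) = r \<and> col (e i) = c \<and> d = Suc c \<and> tri c = q \<and> bit (q + d) r))
    = (e i \<in> Qset)" (is "?lhs = _") if e: "\<And>x. e x \<le> n" for n e
  proof -
    have Qset: "e i \<in> Qset \<longleftrightarrow> bit (tri (col (e i)) + Suc (col (e i))) (row (e i))"
      by (simp add: Qset_def bit_iff_odd tri_Suc)
    consider "e i = 0" | "e i = 1" | "2 \<le> e i" by linarith
    then show ?thesis
    proof cases
      case 1
      have "col 0 = 0" "row 0 = 0" using col_tri_plus[of 0 0] row_tri_plus[of 0 0] by simp_all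
      then show ?thesis using 1 Qset by (simp add: bit_iff_odd)
    next
      case 2
      have "col 1 = 1" "row 1 = 0" using col_tri_plus[of 0 1] row_tri_plus[of 0 1] by (simp_all add: tri_def)
      then show ?thesis using 2 Qset by (simp add: tri_def bit_iff_odd)
    next
      case 3
      then have "Suc (col (e i)) \<le> n" "row (e i) \<le> n" "tri (col (e i)) \<le> n"
        using Suc_col_le[OF 3] row_le[of "e i"] tri_col_le[of "e i"] e[of i] by linarith+
      then show ?thesis using 3 unfolding Qset by auto
    qed
  qed
qed

lemma definable_ell_LCQ: "definable ell_Bit (\<lambda>n e. map e [0..<k] \<in> ell_LCQ p)"
proof -
  have upt: "[0..<2] = [0, 1]" "[0..<1] = [0]" by (simp_all add: upt_rec)
  have len: "length xs = (case p of PLess \<Rightarrow> 2 | PLhd \<Rightarrow> 2 | _ \<Rightarrow> 1)" if "xs \<in> ell_LCQ p" for xs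
    using that by (cases p) auto
  show ?thesis
  proof (cases "k = (case p of PLess \<Rightarrow> 2 | PLhd \<Rightarrow> 2 | _ \<Rightarrow> 1)")
    case False
    then have "\<not> map e [0..<k] \<in> ell_LCQ p" for e using len[of "map e [0..<k]"] by auto
    then show ?thesis by (simp add: definable_False)
  next
    case True
    then show ?thesis
      using upt definable_less_Bit[of 0 1] definable_lhd[of 0 1] definable_Cset[of 0] definable_Qset[of 0]
      by (cases p) simp_all
  qed
qed

section \<open>Definability from the row-column predicates\<close>

lemma definable_less_LCQ: "definable ell_LCQ (\<lambda>n e. e i < e j)"
proof (rule definable_cong)
  show "definable ell_LCQ (\<lambda>n e. map e [i, j] \<in> ell_LCQ PLess)" by (rule definable_pred)
qed simp

lemma definable_lhd_LCQ: "definable ell_LCQ (\<lambda>n e. lhd (e i) (e j))"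
proof (rule definable_cong)
  show "definable ell_LCQ (\<lambda>n e. map e [i, j] \<in> ell_LCQ PLhd)" by (rule definable_pred)
qed simp

lemma definable_Cset_LCQ: "definable ell_LCQ (\<lambda>n e. e i \<in> Cset)"
proof (rule definable_cong)
  show "definable ell_LCQ (\<lambda>n e. map e [i] \<in> ell_LCQ PC)" by (rule definable_pred)
qed simp

lemma definable_Qset_LCQ: "definable ell_LCQ (\<lambda>n e. e i \<in> Qset)"
proof (rule definable_cong)
  show "definable ell_LCQ (\<lambda>n e. map e [i] \<in> ell_LCQ PQ)" by (rule definable_pred)
qed simp

interpretation LCQ: definable_order ell_LCQ
  by unfold_locales (rule definable_less_LCQ)

lemmas lcq_intros = fo_intros LCQ.definable_less LCQ.definable_le LCQ.definable_Suc
  LCQ.definable_const definable_lhd_LCQ definable_Cset_LCQ definable_Qset_LCQ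

section \<open>Comparing rows and columns by the two orders\<close>

lemma col_row_Suc:
  "col (Suc x) = (if row x = col x then Suc (col x) else col x) \<and>
   row (Suc x) = (if row x = col x then 0 else Suc (row x))"
proof (cases "row x = col x")
  case True
  then have "Suc x = tri (Suc (col x)) + 0" using tri_plus_row[of x] by (simp add: tri_Suc)
  then show ?thesis using True by (metis col_tri_plus le0 row_tri_plus)
next
  case False
  then have "Suc (row x) \<le> col x" using row_le_col[of x] by simp
  moreover have "Suc x = tri (col x) + Suc (row x)" using tri_plus_row[of x] by simp
  ultimately show ?thesis using False by (metis col_tri_plus row_tri_plus)
qed

lemma row_0 [simp]: "row 0 = 0" and col_0 [simp]: "col 0 = 0"
  using col_tri_plus[of 0 0] row_tri_plus[of 0 0] by simp_all

lemma col_less_if_less: "col x < col y \<Longrightarrow> x < y"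
proof -
  assume "col x < col y"
  then have "tri (Suc (col x)) \<le> tri (col y)" by simp
  then show ?thesis using less_tri_Suc_col[of x] tri_col_le[of y] by linarith
qed

text \<open>Along \<open><\<close> the row rises within a column and drops to 0 at the next one, so
  a new column shows as a descent of \<open>lhd\<close>. The step from 0 to 1 is no descent, as
  column 0 has a single cell.\<close>

lemma row_eq_0_iff: "row x = 0 \<longleftrightarrow> x = 0 \<or> x = 1 \<or> (\<exists>y. x = Suc y \<and> lhd x y)"
proof (cases x)
  case 0
  then show ?thesis by simp
next
  case (Suc y)
  have "y = 0" if "col y = 0" using that row_le_col[of y] tri_plus_row[of y] by simp
  then show ?thesis unfolding Suc using col_row_Suc[of y] by (cases "y = 0") (auto simp: lhd_def)
qed

lemma definable_row_eq_0: "definable ell_LCQ (\<lambda>n e. row (e i) = 0)"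
proof (rule definable_cong)
  show "definable ell_LCQ (\<lambda>n e. e i = 0 \<or> e i = 1 \<or> (\<exists>y\<le>n. e i = Suc y \<and> lhd (e i) y))"
    by (intro lcq_intros)
  show "(e i = 0 \<or> e i = 1 \<or> (\<exists>y\<le>n. e i = Suc y \<and> lhd (e i) y)) = (row (e i) = 0)"
    if "\<And>x. e x \<le> n" for n e
    unfolding row_eq_0_iff using that[of i] by auto
qed

lemma definable_qq: "definable ell_LCQ (\<lambda>n e. e j = qq (e i))"
proof (rule definable_cong)
  show "definable ell_LCQ (\<lambda>n e. row (e j) = 0 \<and> e j \<le> e i \<and>
    (\<forall>z\<le>n. row z = 0 \<longrightarrow> z \<le> e i \<longrightarrow> z \<le> e j))"
    by (intro lcq_intros definable_row_eq_0)
  show "(row (e j) = 0 \<and> e j \<le> e i \<and> (\<forall>z\<le>n. row z = 0 \<longrightarrow> z \<le> e i \<longrightarrow> z \<le> e j)) = (e j = qq (e i))"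
    if e: "\<And>x. e x \<le> n" for n e
  proof -
    have q: "row (qq (e i)) = 0" "qq (e i) \<le> e i"
      using row_tri_plus[of 0] tri_col_le[of "e i"] by (simp_all add: qq_def)
    have max: "z \<le> qq (e i)" if "row z = 0" "z \<le> e i" for z
      using tri_plus_row[of z] that le_col[of "col z" "e i"] by (simp add: qq_def) (metis tri_le_iff)
    have "qq (e i) \<le> n" using q(2) e[of i] by linarith
    then show ?thesis using q max by (metis antisym)
  qed
qed

lemma definable_col_eq: "definable ell_LCQ (\<lambda>n e. col (e i) = col (e j))"
proof (rule definable_cong)
  show "definable ell_LCQ (\<lambda>n e. \<exists>q\<le>n. q = qq (e i) \<and> q = qq (e j))"
    by (intro lcq_intros definable_qq)
  show "(\<exists>q\<le>n. q = qq (e i) \<and> q = qq (e j)) = (col (e i) = col (e j))"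
    if e: "\<And>x. e x \<le> n" for n e
    using order_trans[OF tri_col_le e[of i]] by (auto simp: qq_def)
qed

lemma Suc_col_eq_iff: "Suc (col x) = col y \<longleftrightarrow> (\<exists>p. qq y = Suc p \<and> col p = col x)"
proof -
  have "col p = c" if "tri (Suc c) = Suc p" for p c
    using that by (intro col_eqI) (simp_all add: tri_Suc)
  then have "(\<exists>p. tri (Suc c) = Suc p \<and> col p = d) \<longleftrightarrow> c = d" for c d
    by (auto simp: tri_Suc)
  then show ?thesis unfolding qq_def by (cases "col y") auto
qed

lemma definable_Suc_col_eq: "definable ell_LCQ (\<lambda>n e. Suc (col (e i)) = col (e j))"
proof (rule definable_cong)
  show "definable ell_LCQ (\<lambda>n e. \<exists>q\<le>n. \<exists>p\<le>n. q = qq (e j) \<and> q = Suc p \<and> col p = col (e i))"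
    by (intro lcq_intros definable_qq definable_col_eq)
  show "(\<exists>q\<le>n. \<exists>p\<le>n. q = qq (e j) \<and> q = Suc p \<and> col p = col (e i)) = (Suc (col (e i)) = col (e j))"
    if e: "\<And>x. e x \<le> n" for n e
  proof -
    have "qq (e j) \<le> n" using tri_col_le[of "e j"] e[of j] by (simp add: qq_def)
    then show ?thesis unfolding Suc_col_eq_iff by (auto simp: Suc_le_eq intro: less_imp_le)
  qed
qed

text \<open>Earlier columns reach at most row \<open>col x - 1\<close>, and a tie there is decided
  by the column; so exactly the last two cells of a column lie above everything smaller.\<close>

lemma all_less_lhd_iff: "(\<forall>z<x. lhd z x) \<longleftrightarrow> col x \<le> Suc (row x)"
proof
  assume *: "\<forall>z<x. lhd z x"
  show "col x \<le> Suc (row x)"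
  proof (rule ccontr)
    assume "\<not> col x \<le> Suc (row x)"
    then obtain c where c: "col x = Suc c" "row x < c" by (cases "col x") auto
    have z: "col (tri c + c) = c" "row (tri c + c) = c" by simp_all
    then have "tri c + c < x" using c col_less_if_less[of "tri c + c" x] by simp
    then have "lhd (tri c + c) x" using * by blast
    then show False using z c by (simp add: lhd_def)
  qed
next
  assume le: "col x \<le> Suc (row x)"
  show "\<forall>z<x. lhd z x"
  proof (intro allI impI)
    fix z assume "z < x"
    then have "\<not> col x < col z" using col_less_if_less[of x z] by auto
    then consider "col z < col x" | "col z = col x" by linarith
    then show "lhd z x"
    proof cases
      case 1
      then show ?thesis using le row_le_col[of z] unfolding lhd_def by linarith
    next
      case 2
      then show ?thesis using \<open>z < x\<close> tri_plus_row[of z] tri_plus_row[of x] unfolding lhd_def by simp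
    qed
  qed
qed

text \<open>If the predecessor is one of the last two cells of its column, then \<open>x\<close>
  ends that column or starts the next; \<open>row x \<noteq> 0\<close> rules out the latter.\<close>

lemma row_eq_col_iff:
  "row x = col x \<longleftrightarrow> x = 0 \<or> row x \<noteq> 0 \<and> (\<exists>p. x = Suc p \<and> (\<forall>z<p. lhd z p))"
proof (cases x)
  case 0
  then show ?thesis by simp
next
  case (Suc p)
  then show ?thesis unfolding all_less_lhd_iff
    using col_row_Suc[of p] row_le_col[of p] row_le_col[of x] by auto
qed

lemma definable_row_eq_col: "definable ell_LCQ (\<lambda>n e. row (e i) = col (e i))"
proof (rule definable_cong)
  show "definable ell_LCQ (\<lambda>n e. e i = 0 \<or> \<not> row (e i) = 0 \<and>
    (\<exists>p\<le>n. e i = Suc p \<and> (\<forall>z\<le>n. z < p \<longrightarrow> lhd z p)))"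
    by (intro lcq_intros definable_row_eq_0)
  show "(e i = 0 \<or> \<not> row (e i) = 0 \<and> (\<exists>p\<le>n. e i = Suc p \<and> (\<forall>z\<le>n. z < p \<longrightarrow> lhd z p)))
    = (row (e i) = col (e i))" if e: "\<And>x. e x \<le> n" for n e
    unfolding row_eq_col_iff using e[of i] by (auto simp: less_le_trans)
qed

text \<open>Since \<open>row \<le> col\<close>, the diagonal cell is the first of its row under
  \<open>lhd\<close>, so preceding it means lying in a lower row. The diagonal cell of the row of
  \<open>y\<close> is at most \<open>y\<close>, hence in the universe.\<close>

lemma row_less_iff:
  "row x < row y \<longleftrightarrow> (\<exists>d\<le>y. row d = col d \<and> lhd x d \<and> (d = y \<or> lhd d y))"
proof
  assume "row x < row y"
  define d where "d = tri (row y) + row y"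
  have d: "row d = row y" "col d = row y" by (simp_all add: d_def)
  have "tri (row y) \<le> tri (col y)" using row_le_col[of y] by simp
  then have "d \<le> y" using tri_plus_row[of y] unfolding d_def by linarith
  moreover have "d = y \<or> lhd d y"
    using d row_le_col[of y] tri_plus_row[of y] unfolding lhd_def by (auto simp: d_def)
  ultimately show "\<exists>d\<le>y. row d = col d \<and> lhd x d \<and> (d = y \<or> lhd d y)"
    using d \<open>row x < row y\<close> by (intro exI[of _ d]) (simp add: lhd_def)
next
  assume "\<exists>d\<le>y. row d = col d \<and> lhd x d \<and> (d = y \<or> lhd d y)"
  then show "row x < row y" using row_le_col[of x] unfolding lhd_def by auto
qed

lemma definable_row_less: "definable ell_LCQ (\<lambda>n e. row (e i) < row (e j))"
proof (rule definable_cong)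
  show "definable ell_LCQ (\<lambda>n e. \<exists>d\<le>n. d \<le> e j \<and> row d = col d \<and> lhd (e i) d \<and> (d = e j \<or> lhd d (e j)))"
    by (intro lcq_intros definable_row_eq_col)
  show "(\<exists>d\<le>n. d \<le> e j \<and> row d = col d \<and> lhd (e i) d \<and> (d = e j \<or> lhd d (e j))) = (row (e i) < row (e j))"
    if e: "\<And>x. e x \<le> n" for n e
    unfolding row_less_iff using e[of j] by (auto intro: order_trans)
qed

lemma definable_row_eq: "definable ell_LCQ (\<lambda>n e. row (e i) = row (e j))"
proof (rule definable_cong)
  show "definable ell_LCQ (\<lambda>n e. \<not> row (e i) < row (e j) \<and> \<not> row (e j) < row (e i))"
    by (intro lcq_intros definable_row_less)
qed auto

lemmas row_intros = lcq_intros definable_col_eq definable_Suc_col_eq definable_row_eq_col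
  definable_row_less definable_row_eq

section \<open>Reading bits from the columns\<close>

text \<open>Column \<open>i - 1\<close> has exactly the rows below \<open>i\<close>; by this bound
  it has room for every bit of \<open>tri i\<close>.\<close>

lemma tri_less_exp: "tri i < 2 ^ i"
proof -
  have "tri (Suc i) < 2 ^ Suc i" for i
  proof (induction i)
    case (Suc i)
    have "Suc (Suc i) \<le> 2 ^ Suc i" using less_exp[of "Suc i"] by (simp only: Suc_le_eq)
    then show ?case using Suc tri_Suc[of "Suc i"] unfolding power_Suc[of 2 "Suc i"] by linarith
  qed (simp add: tri_def)
  then show ?thesis by (cases i) simp_all
qed

text \<open>Q in column \<open>c\<close> refers to \<open>c + 1\<close>, so the bits stand one
  column earlier. Column 0 has no predecessor, consistently with \<open>tri 0\<close> having no
  bits.\<close>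

lemma bit_qq_iff: "bit (qq x) j \<longleftrightarrow> (\<exists>z. Suc (col z) = col x \<and> row z = j \<and> z \<in> Qset)"
proof
  assume bit: "bit (qq x) j"
  then have "j < col x" using not_bit_if_less_exp[OF tri_less_exp] by (metis not_less qq_def)
  then obtain c where c: "col x = Suc c" "j \<le> c" by (cases "col x") auto
  then show "\<exists>z. Suc (col z) = col x \<and> row z = j \<and> z \<in> Qset"
    using bit by (intro exI[of _ "tri c + j"]) (simp add: Qset_def qq_def bit_iff_odd)
qed (auto simp: Qset_def qq_def bit_iff_odd)

lemma bit_col_iff: "bit (col x) j \<longleftrightarrow> (\<exists>z. Suc (col z) = col x \<and> row z = j \<and> z \<in> Cset)"
proof
  assume bit: "bit (col x) j"
  then have "j < col x" by (rule less_if_bit)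
  then obtain c where c: "col x = Suc c" "j \<le> c" by (cases "col x") auto
  then show "\<exists>z. Suc (col z) = col x \<and> row z = j \<and> z \<in> Cset"
    using bit by (intro exI[of _ "tri c + j"]) (simp add: Cset_def bit_iff_odd)
next
  assume "\<exists>z. Suc (col z) = col x \<and> row z = j \<and> z \<in> Cset"
  then show "bit (col x) j" by (metis Cset_def Suc_eq_plus1 bit_iff_odd mem_Collect_eq)
qed

lemma le_if_Suc_col_eq: "Suc (col z) = col x \<Longrightarrow> x \<le> n \<Longrightarrow> z \<le> n"
  using col_less_if_less[of z x] by simp

lemma definable_bit_qq: "definable ell_LCQ (\<lambda>n e. bit (qq (e i)) (row (e j)))"
proof (rule definable_cong)
  show "definable ell_LCQ (\<lambda>n e. \<exists>z\<le>n. Suc (col z) = col (e i) \<and> row z = row (e j) \<and> z \<in> Qset)"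
    by (intro row_intros)
  show "(\<exists>z\<le>n. Suc (col z) = col (e i) \<and> row z = row (e j) \<and> z \<in> Qset) = bit (qq (e i)) (row (e j))"
    if e: "\<And>x. e x \<le> n" for n e
    unfolding bit_qq_iff using le_if_Suc_col_eq[OF _ e[of i]] by blast
qed

lemma definable_bit_col: "definable ell_LCQ (\<lambda>n e. bit (col (e i)) (row (e j)))"
proof (rule definable_cong)
  show "definable ell_LCQ (\<lambda>n e. \<exists>z\<le>n. Suc (col z) = col (e i) \<and> row z = row (e j) \<and> z \<in> Cset)"
    by (intro row_intros)
  show "(\<exists>z\<le>n. Suc (col z) = col (e i) \<and> row z = row (e j) \<and> z \<in> Cset) = bit (col (e i)) (row (e j))"
    if e: "\<And>x. e x \<le> n" for n e
    unfolding bit_col_iff using le_if_Suc_col_eq[OF _ e[of i]] by blast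
qed

lemma ex_diagonal: "\<exists>d\<le>x. row d = row x \<and> col d = row x"
proof -
  have "tri (row x) \<le> tri (col x)" using row_le_col[of x] by simp
  then have "tri (row x) + row x \<le> x" using tri_plus_row[of x] by linarith
  then show ?thesis by (intro exI[of _ "tri (row x) + row x"]) simp
qed

lemma definable_bit_row: "definable ell_LCQ (\<lambda>n e. bit (row (e i)) (row (e j)))"
proof (rule definable_cong)
  show "definable ell_LCQ (\<lambda>n e. \<exists>d\<le>n. row d = row (e i) \<and> row d = col d \<and> bit (col d) (row (e j)))"
    by (intro row_intros definable_bit_col)
  show "(\<exists>d\<le>n. row d = row (e i) \<and> row d = col d \<and> bit (col d) (row (e j))) = bit (row (e i)) (row (e j))"
    if e: "\<And>x. e x \<le> n" for n e
    using ex_diagonal[of "e i"] e[of i] by (metis order_trans)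
qed

lemma ex_row: "j \<le> row x \<Longrightarrow> \<exists>z\<le>x. row z = j"
  using tri_plus_row[of x] row_le_col[of x] by (intro exI[of _ "tri (col x) + j"]) simp

text \<open>Positions are represented by rows of elements. Carry lookahead only inspects positions
  below \<open>row (e j)\<close>, and all of these occur as rows in the column of
  \<open>e j\<close>, so quantifying over elements loses nothing.\<close>

lemma definable_bit_at_row: "definable ell_LCQ (\<lambda>n e. bit (e i) (row (e j)))"
proof (rule definable_cong)
  show "definable ell_LCQ (\<lambda>n e. (bit (qq (e i)) (row (e j)) \<longleftrightarrow> bit (row (e i)) (row (e j))) \<longleftrightarrow>
    (\<exists>k\<le>n. row k < row (e j) \<and> bit (qq (e i)) (row k) \<and> bit (row (e i)) (row k) \<and>
      (\<forall>l\<le>n. row k < row l \<and> row l < row (e j) \<longrightarrow> bit (qq (e i)) (row l) \<or> bit (row (e i)) (row l))))"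
    by (intro row_intros definable_bit_qq definable_bit_row)
  show "((bit (qq (e i)) (row (e j)) \<longleftrightarrow> bit (row (e i)) (row (e j))) \<longleftrightarrow>
    (\<exists>k\<le>n. row k < row (e j) \<and> bit (qq (e i)) (row k) \<and> bit (row (e i)) (row k) \<and>
      (\<forall>l\<le>n. row k < row l \<and> row l < row (e j) \<longrightarrow> bit (qq (e i)) (row l) \<or> bit (row (e i)) (row l))))
    = bit (e i) (row (e j))" if e: "\<And>x. e x \<le> n" for n e
  proof -
    have ex: "\<exists>z\<le>n. row z = k" if "k < row (e j)" for k
      using ex_row[of k "e j"] that e[of j] by (meson less_imp_le order_trans)
    have all: "(\<forall>l\<le>n. k < row l \<and> row l < row (e j) \<longrightarrow> P (row l)) \<longleftrightarrow>
        (\<forall>l. k < l \<and> l < row (e j) \<longrightarrow> P l)" for k P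
      using ex by metis
    have ex': "(\<exists>k\<le>n. row k < row (e j) \<and> P (row k)) \<longleftrightarrow> (\<exists>k<row (e j). P k)" for P
      using ex by metis
    have "bit (e i) (row (e j)) = bit (qq (e i) + row (e i)) (row (e j))"
      using tri_plus_row[of "e i"] by (simp add: qq_def)
    then show ?thesis unfolding bit_add_iff[of "qq (e i)" "row (e i)"]
      unfolding all[of _ "\<lambda>l. bit (qq (e i)) l \<or> bit (row (e i)) l"]
        ex'[of "\<lambda>k. bit (qq (e i)) k \<and> bit (row (e i)) k \<and>
          (\<forall>l. k < l \<and> l < row (e j) \<longrightarrow> bit (qq (e i)) l \<or> bit (row (e i)) l)"] by simp
  qed
qed

lemma tri_plus_le_exp: "4 \<le> i \<Longrightarrow> tri i + i \<le> 2 ^ i"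
proof (induction i rule: dec_induct)
  case (step i)
  have "i + 2 \<le> tri i + i" using Suc_le_tri[of i] step.hyps by simp
  then show ?case using step.IH by (simp add: tri_Suc)
qed (simp add: tri_def)

text \<open>Places the diagonal cell of row \<open>i\<close> in the universe whenever
  \<open>i\<close> can be a bit position. From \<open>i = 4\<close> on it is at most
  \<open>2 ^ i\<close>; for \<open>i = 3\<close> it is 9 while \<open>2 ^ 3 = 8\<close>, which
  dictates the threshold.\<close>

lemma tri_plus_le:
  assumes "9 \<le> n" "2 ^ i \<le> n"
  shows "tri i + i \<le> n"
proof (cases "4 \<le> i")
  case True
  then show ?thesis using tri_plus_le_exp assms(2) by (meson order_trans)
next
  case False
  then have "i \<le> 3" by simp
  then have "tri i + i \<le> tri 3 + 3" by (intro add_mono) simp_all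
  also have "\<dots> = 9" by (simp add: tri_def)
  finally show ?thesis using assms(1) by simp
qed

text \<open>The number \<open>i\<close> is matched with the column \<open>i\<close> by comparing bits. For \<open>n \<ge> 9\<close> all bit
  positions of numbers up to \<open>n\<close> occur as rows; the other \<open>n\<close> are handled separately.\<close>

lemma definable_bit_LCQ: "definable ell_LCQ (\<lambda>n e. bit (e i) (e j))"
proof (rule LCQ.definable_if_eventually[where k = j and Q = "\<lambda>a b _. bit a b"])
  show "definable ell_LCQ (\<lambda>n e. \<exists>y\<le>n. row y = col y \<and> bit (e i) (row y) \<and>
    (\<forall>z\<le>n. bit (e j) (row z) \<longleftrightarrow> bit (col y) (row z)))"
    by (intro row_intros definable_bit_at_row definable_bit_col)
  show "(\<exists>y\<le>n. row y = col y \<and> bit (e i) (row y) \<and> (\<forall>z\<le>n. bit (e j) (row z) \<longleftrightarrow> bit (col y) (row z)))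
    = bit (e i) (e j)" (is "?lhs = _") if n: "9 \<le> n" and e: "\<And>x. e x \<le> n" for n e
  proof
    assume ?lhs
    then obtain y where y: "y \<le> n" "row y = col y" "bit (e i) (row y)"
      "\<And>z. z \<le> n \<Longrightarrow> bit (e j) (row z) \<longleftrightarrow> bit (col y) (row z)" by blast
    have "e j = col y"
    proof (rule bit_eqI)
      fix l
      show "bit (e j) l \<longleftrightarrow> bit (col y) l"
      proof (cases "tri l + l \<le> n")
        case True
        then show ?thesis using y(4)[of "tri l + l"] by simp
      next
        case False
        \<comment> \<open>A position without its diagonal cell has \<open>2 ^ l > n\<close>, so it
          is a bit neither of \<open>e j\<close> nor of \<open>col y\<close>.\<close>
        then have *: "\<not> 2 ^ l \<le> n" using tri_plus_le[OF n] by blast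
        have "\<not> bit x l" if "x \<le> n" for x using exp_le_if_bit[of x l] that * by linarith
        moreover have "col y \<le> n" using col_le[of y] y(1) by linarith
        ultimately show ?thesis using e[of j] by simp
      qed
    qed
    then show "bit (e i) (e j)" using y by simp
  next
    assume bit: "bit (e i) (e j)"
    then have "2 ^ e j \<le> n" using exp_le_if_bit[OF bit] e[of i] by linarith
    then have "tri (e j) + e j \<le> n" by (rule tri_plus_le[OF n])
    then show ?lhs using bit by (intro exI[of _ "tri (e j) + e j"]) simp
  qed
qed

lemma definable_ell_Bit: "definable ell_LCQ (\<lambda>n e. map e [0..<k] \<in> ell_Bit p)"
proof (cases "k = 2")
  case True
  have "[0..<2] = [0, 1]" by (simp add: upt_rec)
  then show ?thesis
    using True definable_bit_LCQ[of 0 1] by (simp add: ell_Bit_def Bit_def bit_iff_odd)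
next
  case False
  then have "map e [0..<k] \<notin> ell_Bit p" for e by (auto simp: ell_Bit_def dest: arg_cong[of _ _ length])
  then show ?thesis by (simp add: definable_False)
qed

theorem theorem3p1:
  shows "same_expressive_power ell_LCQ ell_Bit TYPE('r)"
  unfolding same_expressive_power_def
proof (intro conjI allI)
  show "\<exists>\<psi>. fo_equiv ell_LCQ \<phi> ell_Bit \<psi>" for \<phi> :: "('r, pred4) fo"
    by (rule ex_fo_equiv) (rule definable_ell_LCQ)
  have "\<exists>\<phi>. fo_equiv ell_Bit \<psi> ell_LCQ \<phi>" for \<psi> :: "('r, unit) fo"
    by (rule ex_fo_equiv) (rule definable_ell_Bit)
  moreover have "fo_equiv L1 \<phi> L2 \<psi>" if "fo_equiv L2 \<psi> L1 \<phi>"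
    for L1 :: "pred4 \<Rightarrow> nat list set" and L2 :: "unit \<Rightarrow> nat list set" and \<phi> \<psi>
    using that by (simp add: fo_equiv_def)
  ultimately show "\<exists>\<phi>. fo_equiv ell_LCQ \<phi> ell_Bit \<psi>" for \<psi> :: "('r, unit) fo"
    by blast
qed

end
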